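(* Let $B_1,\dots,B_D$ be resonator blocks and $\lambda\ge0$. Suppose there exists a pseudo-ergodic $\chi'\in\{1,\dots,D\}^{\mathbb{Z}}$ such that $\mathcal{J}(\chi')-\lambda$ is Fredholm. Then for every $\chi_+\in\{1,\dots,D\}^{\mathbb{Z}_{\ge0}}$, at least one of $\mathcal{J}_+(\chi_+)-\lambda$ and $\mathcal{J}_-(\chi_+)-\lambda$ is invertible.
   Context: A resonator block $B_d$ is a finite sequence of $\mathrm{len}(B_d)\ge1$ triples $(v_k,\ell_k,s_k)$ of positive reals (wave speed, length, spacing). For a resonator sequence $(v_i,\ell_i,s_i)$ set $a^{(i)}=-\frac{v_iv_{i+1}}{s_i\sqrt{\ell_i\ell_{i+1}}}$, $b^{(i)}=\frac{v_i^2}{\ell_i}(\frac1{s_{i-1}}+\frac1{s_i})$. $\mathcal{J}(\chi')$: resonators obtained by concatenating $B_{\chi'(j)}$, $j\in\mathbb{Z}$ (first resonator of $B_{\chi'(0)}$ at index $0$); operator on $\ell^2(\mathbb{Z})$, $(\mathcal{J}\mathbf{v})^{(i)}=a^{(i-1)}\mathbf{v}^{(i-1)}+a^{(i)}\mathbf{v}^{(i+1)}+b^{(i)}\mathbf{v}^{(i)}$. $\mathcal{J}_+(\chi_+)$: resonators indexed by $i\ge0$ obtained by concatenating $B_{\chi_+(0)},B_{\chi_+(1)},\dots$ left to right; operator on $\ell^2(\mathbb{Z}_{\ge0})$ given by the same formula for $i\ge1$ and $(\mathcal{J}_+\mathbf{v})^{(0)}=a^{(0)}\mathbf{v}^{(1)}+\frac{v_0^2}{\ell_0s_0}\mathbf{v}^{(0)}$.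 $\mathcal{J}_-(\chi_+)$: resonators indexed by $i\le-1$ obtained by placing the blocks $\dots,B_{\chi_+(1)},B_{\chi_+(0)}$ from left to right (block $B_{\chi_+(k)}$ is the $(k+1)$-th block counted leftwards from the edge, with resonators internally in their original order, the last resonator of $B_{\chi_+(0)}$ having index $-1$); operator on $\ell^2(\mathbb{Z}_{<0})$ given by the bulk formula for $i\le-2$ and $(\mathcal{J}_-\mathbf{v})^{(-1)}=a^{(-2)}\mathbf{v}^{(-2)}+\frac{v_{-1}^2}{\ell_{-1}s_{-2}}\mathbf{v}^{(-1)}$. A sequence is pseudo-ergodic if every finite word over $\{1,\dots,D\}$ occurs in it as a consecutive subword. *)

theory Defs
  imports "HOL-Analysis.Analysis"
begin

type_synonym resonator = "real \<times> real \<times> real"  (* (v, l, s): wave speed, length, spacing *)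

definition res_v :: "resonator \<Rightarrow> real" where "res_v r = fst r"
definition res_l :: "resonator \<Rightarrow> real" where "res_l r = fst (snd r)"
definition res_s :: "resonator \<Rightarrow> real" where "res_s r = snd (snd r)"

definition valid_blocks :: "nat \<Rightarrow> (nat \<Rightarrow> resonator list) \<Rightarrow> bool" where
  "valid_blocks D B \<longleftrightarrow>
     (\<forall>d\<in>{1..D}. B d \<noteq> [] \<and>
        (\<forall>r\<in>set (B d). res_v r > 0 \<and> res_l r > 0 \<and> res_s r > 0))"

definition block_pos :: "(nat \<Rightarrow> 'a list) \<Rightarrow> nat \<Rightarrow> nat" where
  "block_pos L k = (\<Sum>m<k. length (L m))"

definition flat :: "(nat \<Rightarrow> 'a list) \<Rightarrow> nat \<Rightarrow> 'a" where
  "flat L n = (let k = (THE k. block_pos L k \<le> n \<and> n < block_pos L (Suc k))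
               in L k ! (n - block_pos L k))"

text \<open>Resonator sequence of J(chi'): blocks B(chi' j), j in Z, the first resonator of
  B(chi' 0) at index 0.  Index -1-m (m >= 0) is read from the blocks
  B(chi'(-1)), B(chi'(-2)), ... going leftwards, each block traversed in reverse.\<close>
definition res_Z :: "(nat \<Rightarrow> resonator list) \<Rightarrow> (int \<Rightarrow> nat) \<Rightarrow> int \<Rightarrow> resonator" where
  "res_Z B chi i =
     (if 0 \<le> i then flat (\<lambda>k. B (chi (int k))) (nat i)
      else flat (\<lambda>k. rev (B (chi (- 1 - int k)))) (nat (- i - 1)))"

text \<open>Resonator sequences of J_+(chi_+) (indices i >= 0) and of J_-(chi_+) (indices i <= -1),
  stored in one int-indexed sequence: for i >= 0 the blocks B(chi_+ 0), B(chi_+ 1), ... left to right;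
  for i <= -1 the blocks ..., B(chi_+ 1), B(chi_+ 0) with the last resonator of B(chi_+ 0) at -1.\<close>
definition res_half :: "(nat \<Rightarrow> resonator list) \<Rightarrow> (nat \<Rightarrow> nat) \<Rightarrow> int \<Rightarrow> resonator" where
  "res_half B chi i =
     (if 0 \<le> i then flat (\<lambda>k. B (chi k)) (nat i)
      else flat (\<lambda>k. rev (B (chi k))) (nat (- i - 1)))"

definition coef_a :: "(int \<Rightarrow> resonator) \<Rightarrow> int \<Rightarrow> real" where
  "coef_a r i = - (res_v (r i) * res_v (r (i + 1))) /
                  (res_s (r i) * sqrt (res_l (r i) * res_l (r (i + 1))))"

definition coef_b :: "(int \<Rightarrow> resonator) \<Rightarrow> int \<Rightarrow> real" where
  "coef_b r i = (res_v (r i))\<^sup>2 / res_l (r i) * (1 / res_s (r (i - 1)) + 1 / res_s (r i))"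

definition jac :: "(int \<Rightarrow> resonator) \<Rightarrow> (int \<Rightarrow> complex) \<Rightarrow> int \<Rightarrow> complex" where
  "jac r x i = of_real (coef_a r (i - 1)) * x (i - 1) + of_real (coef_a r i) * x (i + 1)
             + of_real (coef_b r i) * x i"

definition jac_plus :: "(int \<Rightarrow> resonator) \<Rightarrow> (int \<Rightarrow> complex) \<Rightarrow> int \<Rightarrow> complex" where
  "jac_plus r x i =
     (if i < 0 then 0
      else if i = 0 then of_real (coef_a r 0) * x 1
             + of_real ((res_v (r 0))\<^sup>2 / (res_l (r 0) * res_s (r 0))) * x 0
      else jac r x i)"

definition jac_minus :: "(int \<Rightarrow> resonator) \<Rightarrow> (int \<Rightarrow> complex) \<Rightarrow> int \<Rightarrow> complex" where
  "jac_minus r x i =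
     (if 0 \<le> i then 0
      else if i = -1 then of_real (coef_a r (-2)) * x (-2)
             + of_real ((res_v (r (-1)))\<^sup>2 / (res_l (r (-1)) * res_s (r (-2)))) * x (-1)
      else jac r x i)"

definition op_shift :: "((int \<Rightarrow> complex) \<Rightarrow> int \<Rightarrow> complex) \<Rightarrow> real
                         \<Rightarrow> (int \<Rightarrow> complex) \<Rightarrow> int \<Rightarrow> complex" where
  "op_shift T lam x i = T x i - of_real lam * x i"

definition l2 :: "int set \<Rightarrow> (int \<Rightarrow> complex) set" where
  "l2 S = {x. (\<forall>i. i \<notin> S \<longrightarrow> x i = 0) \<and> (\<lambda>i. (cmod (x i))\<^sup>2) summable_on UNIV}"

definition l2norm :: "(int \<Rightarrow> complex) \<Rightarrow> real" where
  "l2norm x = sqrt (infsum (\<lambda>i. (cmod (x i))\<^sup>2) UNIV)"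

definition bounded_op_on :: "(int \<Rightarrow> complex) set \<Rightarrow> ((int \<Rightarrow> complex) \<Rightarrow> int \<Rightarrow> complex) \<Rightarrow> bool" where
  "bounded_op_on H T \<longleftrightarrow>
     (\<forall>x\<in>H. T x \<in> H) \<and>
     (\<forall>x\<in>H. \<forall>y\<in>H. \<forall>a b::complex. T (\<lambda>i. a * x i + b * y i) = (\<lambda>i. a * T x i + b * T y i)) \<and>
     (\<exists>C. \<forall>x\<in>H. l2norm (T x) \<le> C * l2norm x)"

definition lin_span :: "(int \<Rightarrow> complex) set \<Rightarrow> (int \<Rightarrow> complex) set" where
  "lin_span F = {y. \<exists>c::(int \<Rightarrow> complex) \<Rightarrow> complex. y = (\<lambda>i. \<Sum>f\<in>F. c f * f i)}"

definition fredholm_on :: "(int \<Rightarrow> complex) set \<Rightarrow> ((int \<Rightarrow> complex) \<Rightarrow> int \<Rightarrow> complex) \<Rightarrow> bool" where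
  "fredholm_on H T \<longleftrightarrow>
     bounded_op_on H T \<and>
     (\<exists>F. finite F \<and> F \<subseteq> H \<and> {x\<in>H. T x = (\<lambda>i. 0)} \<subseteq> lin_span F) \<and>
     (\<forall>y\<in>H. (\<forall>\<epsilon>>0. \<exists>x\<in>H. l2norm (\<lambda>i. T x i - y i) < \<epsilon>) \<longrightarrow> (\<exists>x\<in>H. T x = y)) \<and>
     (\<exists>G. finite G \<and> G \<subseteq> H \<and>
        (\<forall>y\<in>H. \<exists>x\<in>H. \<exists>g\<in>lin_span G. y = (\<lambda>i. T x i + g i)))"

definition invertible_on :: "(int \<Rightarrow> complex) set \<Rightarrow> ((int \<Rightarrow> complex) \<Rightarrow> int \<Rightarrow> complex) \<Rightarrow> bool" where
  "invertible_on H T \<longleftrightarrow>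
     bounded_op_on H T \<and>
     (\<forall>y\<in>H. \<exists>!x. x \<in> H \<and> T x = y) \<and>
     (\<exists>C. \<forall>x\<in>H. l2norm x \<le> C * l2norm (T x))"

definition pseudo_ergodic :: "nat \<Rightarrow> (int \<Rightarrow> nat) \<Rightarrow> bool" where
  "pseudo_ergodic D chi \<longleftrightarrow>
     (\<forall>w. set w \<subseteq> {1..D} \<longrightarrow> (\<exists>j::int. \<forall>m<length w. chi (j + int m) = w ! m))"

end

theory Submission
  imports Defs
begin

text \<open>
  Put \<open>\<chi>\<^sub>+\<close> on the right half-line and its reflection on the left one. The resulting bulk operator is the
  direct sum of \<open>J\<^sub>-\<close> and \<open>J\<^sub>+\<close> plus a rank-one term \<open>s\<^sup>-\<^sup>1 w w\<^sup>T\<close>. If \<open>J - \<lambda>\<close> satisfies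
  \<open>\<parallel>(J - \<lambda>) u\<parallel> \<ge> \<epsilon> \<parallel>u\<parallel>\<close>, then one of \<open>J\<^sub>\<plusminus> - \<lambda>\<close> satisfies the same bound: two violating vectors
  \<open>x\<close>, \<open>y\<close> have a non-trivial combination orthogonal to \<open>w\<close>, on which the rank-one term vanishes.
  A symmetric operator that is bounded below is invertible.

  The lower bound for \<open>J - \<lambda>\<close> comes from the closed range of \<open>J(\<chi>') - \<lambda>\<close>: by pseudo-ergodicity every
  finitely supported vector can be copied arbitrarily far away inside \<open>\<chi>'\<close>, and a tridiagonal operator
  with closed range is bounded below on vectors supported far from the origin.
\<close>

section \<open>Square-summable sequences\<close>

lemma L2_set_le_l2norm:
  assumes "x \<in> l2 UNIV" "finite F"
  shows "L2_set (\<lambda>i. cmod (x i)) F \<le> l2norm x"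
  unfolding L2_set_def l2norm_def
  using assms by (intro real_sqrt_le_mono finite_sum_le_infsum) (auto simp: l2_def)

text \<open>The squared norm is the supremum of its finite partial sums. Minkowski's inequality and
  the other norm bounds are thus inherited from \<open>L2_set\<close>.\<close>

lemma l2_UNIV_I:
  assumes "\<And>F. finite F \<Longrightarrow> L2_set (\<lambda>i. cmod (x i)) F \<le> C"
  shows "x \<in> l2 UNIV" and "l2norm x \<le> C"
proof -
  have C: "C \<ge> 0" using assms[of "{}"] by simp
  have *: "(\<Sum>i\<in>F. (cmod (x i))\<^sup>2) \<le> C\<^sup>2" if "finite F" for F
    using assms[OF that] C unfolding L2_set_def
    by (metis real_sqrt_le_iff real_sqrt_unique)
  have s: "(\<lambda>i. (cmod (x i))\<^sup>2) summable_on UNIV"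
    by (rule nonneg_bdd_above_summable_on) (auto intro!: bdd_aboveI2[where M="C\<^sup>2"] *)
  then show "x \<in> l2 UNIV" by (simp add: l2_def)
  have "infsum (\<lambda>i. (cmod (x i))\<^sup>2) UNIV \<le> C\<^sup>2"
    by (rule infsum_le_finite_sums[OF s]) (use * in auto)
  then show "l2norm x \<le> C"
    unfolding l2norm_def using C by (simp add: real_le_lsqrt)
qed

lemma l2_iff: "x \<in> l2 S \<longleftrightarrow> x \<in> l2 UNIV \<and> (\<forall>i. i \<notin> S \<longrightarrow> x i = 0)"
  by (auto simp: l2_def)

lemma l2norm_nonneg [simp]: "l2norm x \<ge> 0"
  by (simp add: l2norm_def infsum_nonneg)

lemma l2norm_sq: "(l2norm x)\<^sup>2 = infsum (\<lambda>i. (cmod (x i))\<^sup>2) UNIV"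
  by (simp add: l2norm_def infsum_nonneg)

lemma cmod_le_l2norm: "x \<in> l2 UNIV \<Longrightarrow> cmod (x i) \<le> l2norm x"
  using L2_set_le_l2norm[of x "{i}"] by simp

lemma l2_zero [simp]: "(\<lambda>i. 0) \<in> l2 S" and l2norm_zero [simp]: "l2norm (\<lambda>i. 0) = 0"
  by (simp_all add: l2_def l2norm_def)

lemma l2_add:
  assumes "x \<in> l2 S" "y \<in> l2 S"
  shows "(\<lambda>i. x i + y i) \<in> l2 S" and "l2norm (\<lambda>i. x i + y i) \<le> l2norm x + l2norm y"
proof -
  have *: "L2_set (\<lambda>i. cmod (x i + y i)) F \<le> l2norm x + l2norm y" if "finite F" for F
  proof -
    have "L2_set (\<lambda>i. cmod (x i + y i)) F \<le> L2_set (\<lambda>i. cmod (x i) + cmod (y i)) F"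
      by (intro L2_set_mono) (auto intro: norm_triangle_ineq)
    also have "\<dots> \<le> L2_set (\<lambda>i. cmod (x i)) F + L2_set (\<lambda>i. cmod (y i)) F"
      by (rule L2_set_triangle_ineq)
    also have "\<dots> \<le> l2norm x + l2norm y"
      using assms that by (intro add_mono L2_set_le_l2norm) (auto simp: l2_iff[of _ S])
    finally show ?thesis .
  qed
  show "l2norm (\<lambda>i. x i + y i) \<le> l2norm x + l2norm y"
    by (rule l2_UNIV_I(2)[OF *])
  show "(\<lambda>i. x i + y i) \<in> l2 S"
    using l2_UNIV_I(1)[OF *] assms by (simp add: l2_iff[of _ S])
qed

lemma l2_mult_bounded:
  assumes "x \<in> l2 S" "\<And>i. cmod (y i) \<le> K * cmod (x i)" "K \<ge> 0"
  shows "y \<in> l2 S" and "l2norm y \<le> K * l2norm x"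
proof -
  have *: "L2_set (\<lambda>i. cmod (y i)) F \<le> K * l2norm x" if "finite F" for F
  proof -
    have "L2_set (\<lambda>i. cmod (y i)) F \<le> L2_set (\<lambda>i. K * cmod (x i)) F"
      by (intro L2_set_mono assms) auto
    also have "\<dots> = K * L2_set (\<lambda>i. cmod (x i)) F"
      using assms by (simp add: L2_set_right_distrib)
    also have "\<dots> \<le> K * l2norm x"
      using assms that by (intro mult_left_mono L2_set_le_l2norm) (auto simp: l2_iff[of _ S])
    finally show ?thesis .
  qed
  show "l2norm y \<le> K * l2norm x"
    by (rule l2_UNIV_I(2)[OF *])
  have "y i = 0" if "i \<notin> S" for i
    using assms(2)[of i] assms(1) that by (simp add: l2_def)
  then show "y \<in> l2 S"
    using l2_UNIV_I(1)[OF *] by (simp add: l2_iff[of _ S])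
qed

lemma l2_scaleR:
  fixes b :: "int \<Rightarrow> real"
  assumes "x \<in> l2 S" "\<And>i. \<bar>b i\<bar> \<le> K"
  shows "(\<lambda>i. b i *\<^sub>R x i) \<in> l2 S" and "l2norm (\<lambda>i. b i *\<^sub>R x i) \<le> K * l2norm x"
proof -
  have K: "K \<ge> 0" using assms(2)[of 0] by linarith
  have le: "cmod (b i *\<^sub>R x i) \<le> K * cmod (x i)" for i
    using assms(2)[of i] by (simp add: mult_right_mono)
  show "(\<lambda>i. b i *\<^sub>R x i) \<in> l2 S" "l2norm (\<lambda>i. b i *\<^sub>R x i) \<le> K * l2norm x"
    using l2_mult_bounded[of x S "\<lambda>i. b i *\<^sub>R x i" K, OF assms(1) le K] by auto
qed

lemma l2_cmult: "x \<in> l2 S \<Longrightarrow> (\<lambda>i. c * x i) \<in> l2 S"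
  by (rule l2_mult_bounded(1)[where K="cmod c"]) (auto simp: norm_mult)

lemma l2norm_cmult: "l2norm (\<lambda>i. c * x i) = cmod c * l2norm x"
  by (simp add: l2norm_def norm_mult power_mult_distrib infsum_cmult_right' real_sqrt_mult)

lemma l2norm_minus_commute: "l2norm (\<lambda>i. x i - y i) = l2norm (\<lambda>i. y i - x i)"
  by (simp add: l2norm_def norm_minus_commute)

lemma l2_diff:
  assumes "x \<in> l2 S" "y \<in> l2 S"
  shows "(\<lambda>i. x i - y i) \<in> l2 S" and "l2norm (\<lambda>i. x i - y i) \<le> l2norm x + l2norm y"
  using l2_add[OF assms(1) l2_cmult[OF assms(2), of "-1"]] l2norm_cmult[of "-1" y] by simp_all

lemma l2_sum:
  assumes "\<And>n. n \<in> I \<Longrightarrow> x n \<in> l2 S"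
  shows "(\<lambda>i. \<Sum>n\<in>I. x n i) \<in> l2 S"
  using assms by (induction I rule: infinite_finite_induct) (auto intro: l2_add(1))

lemma l2_shift:
  assumes "x \<in> l2 UNIV"
  shows "(\<lambda>i. x (i + k)) \<in> l2 UNIV"
proof -
  have "bij_betw (\<lambda>i. i + k) UNIV (UNIV :: int set)"
    by (rule bij_betwI[where g="\<lambda>i. i - k"]) auto
  from summable_on_reindex_bij_betw[OF this, of "\<lambda>i. (cmod (x i))\<^sup>2"]
  show ?thesis using assms by (simp add: l2_def)
qed

lemma infsum_shift_int: "infsum (\<lambda>i::int. f (i + k)) UNIV = infsum f UNIV"
proof -
  have "bij_betw (\<lambda>i. i + k) UNIV (UNIV :: int set)"
    by (rule bij_betwI[where g="\<lambda>i. i - k"]) auto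
  from infsum_reindex_bij_betw[OF this] show ?thesis .
qed

lemma l2norm_shift: "l2norm (\<lambda>i. x (i + k)) = l2norm x"
  unfolding l2norm_def by (simp add: infsum_shift_int[of "\<lambda>i. (cmod (x i))\<^sup>2"])

section \<open>Completeness of the space of square-summable sequences\<close>

lemma l2_pointwise_limit:
  assumes "\<And>n. x n \<in> l2 S" "\<And>n. l2norm (x n) \<le> C" "\<And>i. (\<lambda>n. x n i) \<longlonglongrightarrow> z i"
  shows "z \<in> l2 S" and "l2norm z \<le> C"
proof -
  have *: "L2_set (\<lambda>i. cmod (z i)) F \<le> C" if "finite F" for F
  proof (rule LIMSEQ_le_const2)
    show "(\<lambda>n. L2_set (\<lambda>i. cmod (x n i)) F) \<longlonglongrightarrow> L2_set (\<lambda>i. cmod (z i)) F"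
      unfolding L2_set_def by (intro tendsto_intros assms)
    show "\<exists>N. \<forall>n\<ge>N. L2_set (\<lambda>i. cmod (x n i)) F \<le> C"
      using L2_set_le_l2norm[OF _ that] assms(1,2) l2_iff order_trans by blast
  qed
  show "l2norm z \<le> C" by (rule l2_UNIV_I(2)[OF *])
  have "z i = 0" if "i \<notin> S" for i
    using assms(3)[of i] assms(1) that by (simp add: l2_def LIMSEQ_const_iff)
  then show "z \<in> l2 S"
    using l2_UNIV_I(1)[OF *] by (simp add: l2_iff[of _ S])
qed

text \<open>Completeness for sequences with geometrically small steps: telescoping yields the
  pointwise limit, and also a rate of convergence in norm.\<close>

lemma l2_geometric_Cauchy:
  assumes mem: "\<And>n. x n \<in> l2 S" and q: "0 \<le> q" "q < 1"
    and step: "\<And>n. l2norm (\<lambda>i. x (Suc n) i - x n i) \<le> C * q ^ n"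
  shows "\<exists>z\<in>l2 S. (\<forall>i. (\<lambda>n. x n i) \<longlonglongrightarrow> z i) \<and>
           (\<forall>n. l2norm (\<lambda>i. z i - x n i) \<le> C * q ^ n / (1 - q))"
proof -
  have C: "C \<ge> 0" using order_trans[OF l2norm_nonneg step[of 0]] by simp
  have memU: "x n \<in> l2 UNIV" for n using mem[of n] l2_iff by blast
  have diff: "l2norm (\<lambda>i. x (n + k) i - x n i) \<le> C * q ^ n * (\<Sum>j<k. q ^ j)" for n k
  proof (induction k)
    case (Suc k)
    have "l2norm (\<lambda>i. x (n + Suc k) i - x n i)
        = l2norm (\<lambda>i. (x (Suc (n + k)) i - x (n + k) i) + (x (n + k) i - x n i))" by simp
    also have "\<dots> \<le> C * q ^ (n + k) + C * q ^ n * (\<Sum>j<k. q ^ j)"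
      by (rule order_trans[OF l2_add(2)[OF l2_diff(1)[OF mem mem] l2_diff(1)[OF mem mem]]])
         (intro add_mono step Suc)
    finally show ?case by (simp add: algebra_simps power_add)
  qed simp
  have geo: "(\<Sum>j<k. q ^ j) \<le> 1 / (1 - q)" for k
    using q by (simp add: sum_gp_strict divide_right_mono)
  have bound: "l2norm (\<lambda>i. x (n + k) i - x n i) \<le> C * q ^ n / (1 - q)" for n k
  proof -
    have "C * q ^ n * (\<Sum>j<k. q ^ j) \<le> C * q ^ n * (1 / (1 - q))"
      using C q by (intro mult_left_mono geo) auto
    with diff[of n k] show ?thesis by simp
  qed
  have conv: "convergent (\<lambda>n. x n i)" for i
  proof -
    have "summable (\<lambda>n. x (Suc n) i - x n i)"
    proof (rule summable_comparison_test)
      show "\<exists>N. \<forall>n\<ge>N. norm (x (Suc n) i - x n i) \<le> C * q ^ n"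
        using order_trans[OF cmod_le_l2norm[OF l2_diff(1)[OF memU memU]] step] by simp
      show "summable (\<lambda>n. C * q ^ n)" using q by (intro summable_mult summable_geometric) auto
    qed
    then have "convergent (\<lambda>n. \<Sum>k<n. x (Suc k) i - x k i)"
      by (simp add: summable_iff_convergent)
    then have "convergent (\<lambda>n. x n i - x 0 i)"
      by (simp add: sum_lessThan_telescope[of "\<lambda>n. x n i"])
    then show ?thesis by (simp add: convergent_diff_const_right_iff)
  qed
  then obtain z where z: "\<And>i. (\<lambda>n. x n i) \<longlonglongrightarrow> z i"
    unfolding convergent_def by metis
  \<comment> \<open>The bound on the differences is uniform in \<open>k\<close>, so it survives the
    pointwise limit in \<open>k\<close> for each fixed \<open>n\<close>.\<close>
  have "(\<lambda>k. x (n + k) i - x n i) \<longlonglongrightarrow> z i - x n i" for n i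
    using LIMSEQ_ignore_initial_segment[OF z[of i], of n]
    by (intro tendsto_diff) (auto simp: add.commute)
  note lim = l2_pointwise_limit[OF l2_diff(1)[OF mem mem] bound this]
  have "z \<in> l2 S" using l2_add(1)[OF lim(1)[of 0] mem[of 0]] by simp
  with z lim(2) show ?thesis by blast
qed

section \<open>Inner products and orthogonal sums\<close>

lemma inner_summable:
  assumes "x \<in> l2 UNIV" "y \<in> l2 UNIV"
  shows "(\<lambda>i. x i \<bullet> y i) summable_on UNIV"
proof (rule abs_summable_summable, rule Infinite_Sum.abs_summable_on_comparison_test')
  show "(\<lambda>i. (cmod (x i))\<^sup>2 + (cmod (y i))\<^sup>2) summable_on UNIV"
    using assms by (intro summable_on_add) (auto simp: l2_def)
  fix i
  have "\<bar>x i \<bullet> y i\<bar> \<le> cmod (x i) * cmod (y i)" by (rule Cauchy_Schwarz_ineq2)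
  also have "\<dots> \<le> (cmod (x i))\<^sup>2 + (cmod (y i))\<^sup>2"
    using sum_squares_bound[of "cmod (x i)" "cmod (y i)"]
      mult_nonneg_nonneg[OF norm_ge_zero norm_ge_zero, of "x i" "y i"] by linarith
  finally show "norm (x i \<bullet> y i) \<le> (cmod (x i))\<^sup>2 + (cmod (y i))\<^sup>2" by simp
qed

text \<open>On complex numbers \<open>\<bullet>\<close> is the real part of the Hermitian product,
  which is all that the expansion of a squared norm sees.\<close>

lemma l2norm_sq_diff:
  assumes x: "x \<in> l2 UNIV" and y: "y \<in> l2 UNIV"
  shows "(l2norm (\<lambda>i. x i - y i))\<^sup>2
    = (l2norm x)\<^sup>2 - 2 * infsum (\<lambda>i. x i \<bullet> y i) UNIV + (l2norm y)\<^sup>2"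
proof -
  have eq: "(cmod (x i - y i))\<^sup>2 = ((cmod (x i))\<^sup>2 + (-2) * (x i \<bullet> y i)) + (cmod (y i))\<^sup>2" for i
    by (simp add: power2_norm_eq_inner inner_diff_left inner_diff_right inner_commute)
  have sx: "(\<lambda>i. (cmod (x i))\<^sup>2) summable_on UNIV" and sy: "(\<lambda>i. (cmod (y i))\<^sup>2) summable_on UNIV"
    using x y by (auto simp: l2_def)
  have sxy: "(\<lambda>i. (-2) * (x i \<bullet> y i)) summable_on UNIV"
    by (intro summable_on_cmult_right inner_summable x y)
  show ?thesis
    unfolding l2norm_sq eq
    by (simp only: infsum_add[OF summable_on_add[OF sx sxy] sy] infsum_add[OF sx sxy] infsum_cmult_right')
qed

lemma l2norm_sq_disjoint_add:
  assumes x: "x \<in> l2 UNIV" and y: "y \<in> l2 UNIV" and disj: "\<And>i. x i = 0 \<or> y i = 0"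
  shows "(l2norm (\<lambda>i. x i + y i))\<^sup>2 = (l2norm x)\<^sup>2 + (l2norm y)\<^sup>2"
proof -
  have "(cmod (x i + y i))\<^sup>2 = (cmod (x i))\<^sup>2 + (cmod (y i))\<^sup>2" for i
    using disj[of i] by auto
  then show ?thesis
    using x y unfolding l2norm_sq by (simp add: infsum_add l2_def)
qed

lemma l2_finite_support:
  assumes "\<And>i. \<bar>i\<bar> > N \<Longrightarrow> x i = 0"
  shows "x \<in> l2 UNIV"
proof -
  have "{i. (cmod (x i))\<^sup>2 \<noteq> 0} \<subseteq> {-N..N}"
    using assms by (force simp: abs_less_iff not_less)
  then have "finite {i \<in> UNIV. (cmod (x i))\<^sup>2 \<noteq> 0}"
    using finite_subset by auto
  then show ?thesis
    unfolding l2_def by (simp add: finite_nonzero_values_imp_summable_on)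
qed

section \<open>Symmetric tridiagonal operators\<close>

text \<open>Real symmetric matrix with diagonal \<open>d\<close>, where \<open>a i\<close> couples
  the sites \<open>i\<close> and \<open>i + 1\<close>. It acts on arbitrary sequences, so it can
  also be applied to formal series outside l2.\<close>

definition tri :: "(int \<Rightarrow> real) \<Rightarrow> (int \<Rightarrow> real) \<Rightarrow> (int \<Rightarrow> complex) \<Rightarrow> int \<Rightarrow> complex" where
  "tri a d x i = a (i - 1) *\<^sub>R x (i - 1) + a i *\<^sub>R x (i + 1) + d i *\<^sub>R x i"

lemma tri_lin: "tri a d (\<lambda>i. \<alpha> * x i + \<beta> * y i) = (\<lambda>i. \<alpha> * tri a d x i + \<beta> * tri a d y i)"
  by (auto simp: tri_def scaleR_conv_of_real algebra_simps)

lemma tri_add: "tri a d (\<lambda>i. x i + y i) i = tri a d x i + tri a d y i"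
  and tri_diff: "tri a d (\<lambda>i. x i - y i) i = tri a d x i - tri a d y i"
  and tri_cmult: "tri a d (\<lambda>i. c * x i) i = c * tri a d x i"
  by (auto simp: tri_def scaleR_conv_of_real algebra_simps)

lemma tri_sum: "tri a d (\<lambda>i. \<Sum>n\<in>I. x n i) i = (\<Sum>n\<in>I. tri a d (x n) i)"
  by (simp add: tri_def scaleR_sum_right sum.distrib)

text \<open>Each coordinate of the image involves only three entries, so pointwise convergence
  suffices.\<close>

lemma tri_tendsto:
  assumes "\<And>i. ((\<lambda>n. x n i) \<longlongrightarrow> z i) F"
  shows "((\<lambda>n. tri a d (x n) i) \<longlongrightarrow> tri a d z i) F"
  unfolding tri_def by (intro tendsto_intros assms)

lemma tri_bounded:
  assumes a: "\<And>i. \<bar>a i\<bar> \<le> K" and d: "\<And>i. \<bar>d i\<bar> \<le> K" and x: "x \<in> l2 UNIV"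
  shows "tri a d x \<in> l2 UNIV" and "l2norm (tri a d x) \<le> 3 * K * l2norm x"
proof -
  have K: "K \<ge> 0" using a[of 0] by linarith
  have xs: "(\<lambda>i. x (i + k)) \<in> l2 UNIV" for k by (rule l2_shift[OF x])
  have 1: "(\<lambda>i. a (i + -1) *\<^sub>R x (i + -1)) \<in> l2 UNIV" "l2norm (\<lambda>i. a (i + -1) *\<^sub>R x (i + -1)) \<le> K * l2norm x"
    using l2_scaleR[OF xs[of "-1"], of "\<lambda>i. a (i + -1)" K] a unfolding l2norm_shift by auto
  have 2: "(\<lambda>i. a i *\<^sub>R x (i + 1)) \<in> l2 UNIV" "l2norm (\<lambda>i. a i *\<^sub>R x (i + 1)) \<le> K * l2norm x"
    using l2_scaleR[OF xs[of 1], of a K] a unfolding l2norm_shift by auto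
  have 3: "(\<lambda>i. d i *\<^sub>R x i) \<in> l2 UNIV" "l2norm (\<lambda>i. d i *\<^sub>R x i) \<le> K * l2norm x"
    using l2_scaleR[OF x, of d K] d by auto
  note s = l2_add[OF l2_add(1)[OF 1(1) 2(1)] 3(1)]
  have eq: "tri a d x = (\<lambda>i. a (i + -1) *\<^sub>R x (i + -1) + a i *\<^sub>R x (i + 1) + d i *\<^sub>R x i)"
    by (simp add: tri_def fun_eq_iff)
  show "tri a d x \<in> l2 UNIV" unfolding eq by (rule s(1))
  show "l2norm (tri a d x) \<le> 3 * K * l2norm x" unfolding eq
    using s(2) l2_add(2)[OF 1(1) 2(1)] 1(2) 2(2) 3(2) by linarith
qed

text \<open>The two sides differ only in which off-diagonal products appear at \<open>i\<close> and
  which at \<open>i - 1\<close>; the sum over all integers does not notice the shift.\<close>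

lemma tri_symmetric:
  assumes a: "\<And>i. \<bar>a i\<bar> \<le> K" and d: "\<And>i. \<bar>d i\<bar> \<le> K" and x: "x \<in> l2 UNIV" and y: "y \<in> l2 UNIV"
  shows "infsum (\<lambda>i. x i \<bullet> tri a d y i) UNIV = infsum (\<lambda>i. tri a d x i \<bullet> y i) UNIV"
proof -
  have K: "K \<ge> 0" using a[of 0] by linarith
  have sa: "(\<lambda>i. a i * (u i \<bullet> v (i + 1))) summable_on UNIV" if "u \<in> l2 UNIV" "v \<in> l2 UNIV" for u v
  proof -
    have "(\<lambda>i. a i *\<^sub>R u i) \<in> l2 UNIV"
      using l2_scaleR(1)[OF that(1), of a K] a by auto
    from inner_summable[OF this l2_shift[OF that(2), of 1]] show ?thesis by simp
  qed
  have sd: "(\<lambda>i. d i * (x i \<bullet> y i)) summable_on UNIV"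
  proof -
    have "(\<lambda>i. d i *\<^sub>R x i) \<in> l2 UNIV"
      using l2_scaleR(1)[OF x, of d K] d by auto
    from inner_summable[OF this y] show ?thesis by simp
  qed
  have sh: "(\<lambda>i. f (i - 1)) summable_on UNIV \<and> infsum (\<lambda>i. f (i - 1)) UNIV = infsum f UNIV"
    if "f summable_on UNIV" for f :: "int \<Rightarrow> real"
  proof -
    have "bij_betw (\<lambda>i. i - 1) UNIV (UNIV :: int set)"
      by (rule bij_betwI[where g="\<lambda>i. i + 1"]) auto
    from summable_on_reindex_bij_betw[OF this, of f] infsum_reindex_bij_betw[OF this, of f] that
    show ?thesis by simp
  qed
  define f g where "f = (\<lambda>i. a i * (x i \<bullet> y (i + 1)))" and "g = (\<lambda>i. a i * (y i \<bullet> x (i + 1)))"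
  have fs: "f summable_on UNIV" and gs: "g summable_on UNIV"
    unfolding f_def g_def by (intro sa x y)+
  have "(\<lambda>i. x i \<bullet> tri a d y i) = (\<lambda>i. g (i - 1) + f i + d i * (x i \<bullet> y i))"
    by (auto simp: tri_def f_def g_def inner_add_right inner_add_left inner_commute)
  moreover have "(\<lambda>i. tri a d x i \<bullet> y i) = (\<lambda>i. f (i - 1) + g i + d i * (x i \<bullet> y i))"
    by (auto simp: tri_def f_def g_def inner_add_right inner_add_left inner_commute)
  ultimately show ?thesis
    using sh[OF fs] sh[OF gs] fs gs sd by (simp add: infsum_add summable_on_add)
qed

text \<open>For small \<open>\<epsilon>\<close> the map \<open>x \<mapsto> x - \<epsilon> T (T x - y)\<close> is a contraction, because symmetry gives
  \<open>\<langle>x, T\<^sup>2 x\<rangle> = \<parallel>T x\<parallel>\<^sup>2\<close>; its fixed point solves \<open>T (T x - y) = 0\<close>.\<close>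
lemma tri_surjective:
  assumes a: "\<And>i. \<bar>a i\<bar> \<le> K" and d: "\<And>i. \<bar>d i\<bar> \<le> K"
    and inv: "\<And>x. x \<in> l2 S \<Longrightarrow> tri a d x \<in> l2 S"
    and c: "c > 0" and below: "\<And>x. x \<in> l2 S \<Longrightarrow> c * l2norm x \<le> l2norm (tri a d x)"
    and y: "y \<in> l2 S"
  shows "\<exists>x\<in>l2 S. tri a d x = y"
proof -
  let ?T = "tri a d"
  define M where "M = 3 * K + 1"
  have K: "K \<ge> 0" using a[of 0] by linarith
  have M: "M \<ge> 1" using K by (simp add: M_def)
  have U: "x \<in> l2 UNIV" if "x \<in> l2 S" for x using that l2_iff by blast
  have TM: "l2norm (?T x) \<le> M * l2norm x" if "x \<in> l2 S" for x
    using tri_bounded(2)[of a K d x, OF a d U[OF that]] by (simp add: M_def algebra_simps add_increasing)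
  \<comment> \<open>With this step size the quadratic term of the expanded square, the squared norm
    of \<open>\<epsilon> * T (T x)\<close>, is at most \<open>\<epsilon>\<close> times that of
    \<open>T x\<close>. It thus absorbs only half of the cross term, and the other half gives the
    contraction.\<close>
  define \<epsilon> where "\<epsilon> = 1 / M\<^sup>2"
  have \<epsilon>: "\<epsilon> > 0" "\<epsilon> * M\<^sup>2 = 1" using M by (auto simp: \<epsilon>_def)
  \<comment> \<open>The maximum with 0 covers an empty \<open>S\<close>, where \<open>c\<close> is
    not limited by the operator norm.\<close>
  define q where "q = sqrt (max 0 (1 - \<epsilon> * c\<^sup>2))"
  have q: "0 \<le> q" "q < 1" using \<epsilon> c by (auto simp: q_def)
  have contr: "l2norm (\<lambda>i. x i - \<epsilon> * ?T (?T x) i) \<le> q * l2norm x" if x: "x \<in> l2 S" for x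
  proof -
    have sc: "(\<lambda>i. \<epsilon> * ?T (?T x) i) \<in> l2 S" by (intro l2_cmult inv x)
    have e: "x i \<bullet> (of_real \<epsilon> * ?T (?T x) i) = \<epsilon> * (x i \<bullet> ?T (?T x) i)" for i
      by (simp add: scaleR_conv_of_real[symmetric])
    have ip: "infsum (\<lambda>i. x i \<bullet> (of_real \<epsilon> * ?T (?T x) i)) UNIV = \<epsilon> * (l2norm (?T x))\<^sup>2"
      unfolding e infsum_cmult_right' tri_symmetric[of a K d x "?T x", OF a d U[OF x] U[OF inv[OF x]]]
      by (simp add: l2norm_sq power2_norm_eq_inner)
    have n: "l2norm (\<lambda>i. \<epsilon> * ?T (?T x) i) = \<epsilon> * l2norm (?T (?T x))"
      using \<epsilon> by (simp add: l2norm_cmult)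
    have "(\<epsilon> * l2norm (?T (?T x)))\<^sup>2 \<le> (\<epsilon> * (M * l2norm (?T x)))\<^sup>2"
      using \<epsilon> by (intro power_mono mult_left_mono TM inv x) auto
    also have "\<dots> = \<epsilon> * (\<epsilon> * M\<^sup>2) * (l2norm (?T x))\<^sup>2" by (simp add: power2_eq_square)
    finally have 2: "(\<epsilon> * l2norm (?T (?T x)))\<^sup>2 \<le> \<epsilon> * (l2norm (?T x))\<^sup>2" using \<epsilon> by simp
    have "(c * l2norm x)\<^sup>2 \<le> (l2norm (?T x))\<^sup>2"
      using c by (intro power_mono below x) auto
    then have 3: "\<epsilon> * (c\<^sup>2 * (l2norm x)\<^sup>2) \<le> \<epsilon> * (l2norm (?T x))\<^sup>2"
      using \<epsilon> by (simp add: power_mult_distrib)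
    have "(l2norm (\<lambda>i. x i - \<epsilon> * ?T (?T x) i))\<^sup>2 \<le> (l2norm x)\<^sup>2 - \<epsilon> * (l2norm (?T x))\<^sup>2"
      unfolding l2norm_sq_diff[OF U[OF x] U[OF sc]] ip n using 2 by linarith
    also have "\<dots> \<le> (1 - \<epsilon> * c\<^sup>2) * (l2norm x)\<^sup>2"
      using 3 by (simp add: algebra_simps)
    also have "\<dots> \<le> (q * l2norm x)\<^sup>2"
      unfolding q_def power_mult_distrib by (simp add: mult_right_mono)
    finally show ?thesis
      using q by (simp add: abs_le_square_iff[symmetric])
  qed
  \<comment> \<open>Picard iteration of the contraction, started at 0.\<close>
  define X where "X = rec_nat (\<lambda>i. 0) (\<lambda>_ x i. x i - \<epsilon> * (?T (?T x) i - ?T y i))"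
  have X0: "X 0 = (\<lambda>i. 0)" and XS: "X (Suc n) = (\<lambda>i. X n i - \<epsilon> * (?T (?T (X n)) i - ?T y i))" for n
    by (simp_all add: X_def)
  have Xmem: "X n \<in> l2 S" for n
    by (induction n) (auto simp: X0 XS intro!: l2_diff l2_cmult inv y)
  have step: "l2norm (\<lambda>i. X (Suc n) i - X n i) \<le> l2norm (X 1) * q ^ n" for n
  proof (induction n)
    case 0 then show ?case by (simp add: X0)
  next
    case (Suc n)
    let ?e = "\<lambda>i. X (Suc n) i - X n i"
    have Te: "?T ?e = (\<lambda>i. ?T (X (Suc n)) i - ?T (X n) i)" by (simp add: tri_diff fun_eq_iff)
    have eq: "X (Suc (Suc n)) i - X (Suc n) i = ?e i - \<epsilon> * ?T (?T ?e) i" for i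
      unfolding Te tri_diff fun_cong[OF XS[of "Suc n"]] fun_cong[OF XS[of n], of i]
      by (simp only: right_diff_distrib add_diff_eq diff_add_eq diff_diff_eq2) (simp only: algebra_simps)
    have "l2norm (\<lambda>i. X (Suc (Suc n)) i - X (Suc n) i) \<le> q * l2norm ?e"
      unfolding eq by (rule contr[OF l2_diff(1)[OF Xmem Xmem]])
    also have "\<dots> \<le> q * (l2norm (X 1) * q ^ n)" using Suc q by (intro mult_left_mono) auto
    finally show ?case by (simp add: algebra_simps)
  qed
  obtain z where z: "z \<in> l2 S" "\<And>i. (\<lambda>n. X n i) \<longlonglongrightarrow> z i"
    using l2_geometric_Cauchy[OF Xmem q step] by auto
  have "?T (?T z) i - ?T y i = 0" for i
  proof -
    have "(\<lambda>n. X n i - \<epsilon> * (?T (?T (X n)) i - ?T y i)) \<longlonglongrightarrow> z i - \<epsilon> * (?T (?T z) i - ?T y i)"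
      by (intro tendsto_intros tri_tendsto z)
    moreover have "(\<lambda>n. X n i - \<epsilon> * (?T (?T (X n)) i - ?T y i)) \<longlonglongrightarrow> z i"
      using LIMSEQ_Suc[OF z(2)[of i]] by (simp add: XS)
    ultimately have "z i - \<epsilon> * (?T (?T z) i - ?T y i) = z i" by (rule LIMSEQ_unique)
    then show ?thesis using \<epsilon> by simp
  qed
  \<comment> \<open>The lower bound makes \<open>T\<close> injective, so the residual
    \<open>T z - y\<close>, which lies in the kernel, vanishes.\<close>
  then have "?T (\<lambda>i. ?T z i - y i) = (\<lambda>i. 0)" by (simp add: tri_diff fun_eq_iff)
  moreover have mem: "(\<lambda>i. ?T z i - y i) \<in> l2 S" by (intro l2_diff inv z y)
  ultimately have "c * l2norm (\<lambda>i. ?T z i - y i) \<le> 0" using below[OF mem] by simp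
  then have "l2norm (\<lambda>i. ?T z i - y i) \<le> 0" using c by (simp add: mult_le_0_iff)
  then have "cmod (?T z i - y i) \<le> 0" for i using cmod_le_l2norm[OF U[OF mem], of i] by linarith
  then have "?T z = y" by (auto simp: fun_eq_iff)
  with z(1) show ?thesis by blast
qed

section \<open>Closed range\<close>

text \<open>Three vectors in a plane are linearly dependent. A specific non-zero coefficient is
  returned because the closed-range argument tests the relation along the residue class of its
  index.\<close>

lemma three_pairs_dependent:
  fixes p q :: "nat \<Rightarrow> complex"
  obtains \<gamma> k where "k < 3" "\<gamma> k \<noteq> 0" "(\<Sum>k<3. \<gamma> k * p k) = 0" "(\<Sum>k<3. \<gamma> k * q k) = 0"
proof -
  have *: thesis if "f \<noteq> 0 \<or> g \<noteq> 0 \<or> h \<noteq> 0"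
    "f * p 0 + g * p 1 + h * p 2 = 0" "f * q 0 + g * q 1 + h * q 2 = 0" for f g h
  proof -
    define \<gamma> where "\<gamma> = (\<lambda>k::nat. if k = 0 then f else if k = 1 then g else h)"
    have "(\<Sum>k<3. \<gamma> k * p k) = 0" "(\<Sum>k<3. \<gamma> k * q k) = 0"
      using that by (simp_all add: \<gamma>_def numeral_3_eq_3 numeral_2_eq_2)
    moreover have "\<exists>k<3. \<gamma> k \<noteq> 0"
    proof -
      have "\<gamma> 0 = f" "\<gamma> 1 = g" "\<gamma> 2 = h" by (simp_all add: \<gamma>_def)
      then have "\<gamma> 0 \<noteq> 0 \<or> \<gamma> 1 \<noteq> 0 \<or> \<gamma> 2 \<noteq> 0" using that(1) by simp
      then show ?thesis
        by (elim disjE; intro exI conjI; assumption?) simp_all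
    qed
    ultimately show thesis using \<open>\<And>k \<gamma>. k < 3 \<Longrightarrow> \<gamma> k \<noteq> 0 \<Longrightarrow> _ \<Longrightarrow> _ \<Longrightarrow> thesis\<close> by blast
  qed
  \<comment> \<open>The cross product of \<open>p\<close> and \<open>q\<close> is orthogonal to
    both. If it is zero, the first two pairs are proportional, and a relation between them can be
    read off from their entries.\<close>
  let ?f = "p 1 * q 2 - p 2 * q 1" and ?g = "p 2 * q 0 - p 0 * q 2" and ?h = "p 0 * q 1 - p 1 * q 0"
  show thesis
  proof (cases "?f \<noteq> 0 \<or> ?g \<noteq> 0 \<or> ?h \<noteq> 0")
    case True
    then show thesis by (rule *) (simp_all add: algebra_simps)
  next
    case False
    consider "p 0 \<noteq> 0 \<or> p 1 \<noteq> 0" | "q 0 \<noteq> 0 \<or> q 1 \<noteq> 0" | "p 0 = 0" "q 0 = 0" by blast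
    then show thesis
    proof cases
      case 1 then show thesis using * [of "p 1" "- p 0" 0] False by (auto simp: algebra_simps)
    next
      case 2 then show thesis using * [of "q 1" "- q 0" 0] False by (auto simp: algebra_simps)
    next
      case 3 then show thesis using * [of 1 0 0] by auto
    qed
  qed
qed

text \<open>Since no \<open>a i\<close> vanishes, the three-term recurrence can be solved in both
  directions from two neighbouring values.\<close>

lemma tri_kernel_determined:
  assumes a: "\<And>i. a i \<noteq> 0" and T: "\<And>i. tri a d x i = 0" and x: "x 0 = 0" "x 1 = 0"
  shows "x i = 0"
proof -
  have up: "x (i + 1) = 0" if "x (i - 1) = 0" "x i = 0" for i
    using T[of i] a[of i] that by (simp add: tri_def)
  have down: "x (i - 1) = 0" if "x (i + 1) = 0" "x i = 0" for i
    using T[of i] a[of "i - 1"] that by (simp add: tri_def)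
  have 1: "x (int n) = 0 \<and> x (int n + 1) = 0" for n
  proof (induction n)
    case (Suc n)
    then show ?case using up[of "int n + 1"] by (simp add: algebra_simps)
  qed (use x in auto)
  have 2: "x (- int n) = 0 \<and> x (1 - int n) = 0" for n
  proof (induction n)
    case (Suc n)
    have e: "- int (Suc n) = - int n - 1" "1 - int (Suc n) = - int n" by simp_all
    show ?case unfolding e using Suc down[of "- int n"] by (simp add: add.commute)
  qed (use x in auto)
  show ?thesis using 1[of "nat i"] 2[of "nat (- i)"] by (cases "i \<ge> 0") auto
qed

text \<open>Otherwise there are unit vectors \<open>x\<^sub>n\<close> with disjoint supports and \<open>\<parallel>T x\<^sub>n\<parallel> \<le> 2\<^sup>-\<^sup>n\<close>. For bounded
  \<open>c\<close> the formal series \<open>X\<^sub>c = \<Sum>\<^sub>n c\<^sub>n x\<^sub>n\<close> has \<open>T X\<^sub>c\<close> in the closure of the range, so \<open>X\<^sub>c\<close> agrees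
  modulo \<open>l2\<close> with a formal solution of \<open>T f = 0\<close>. Those form a two-dimensional space, whereas the
  three indicator sequences \<open>c\<close> of the residue classes modulo 3 are independent modulo \<open>l2\<close>.\<close>
lemma tri_closed_range_bounded_below:
  assumes a: "\<And>i. \<bar>a i\<bar> \<le> K" and d: "\<And>i. \<bar>d i\<bar> \<le> K" and a0: "\<And>i. a i \<noteq> 0"
    and closed: "\<And>y. y \<in> l2 UNIV \<Longrightarrow> (\<And>\<epsilon>. \<epsilon> > 0 \<Longrightarrow> \<exists>x\<in>l2 UNIV. l2norm (\<lambda>i. tri a d x i - y i) < \<epsilon>)
        \<Longrightarrow> \<exists>x\<in>l2 UNIV. tri a d x = y"
  shows "\<exists>\<epsilon>>0. \<exists>R::int. \<forall>x N. (\<forall>i. \<bar>i\<bar> > N \<or> \<bar>i\<bar> \<le> R \<longrightarrow> x i = 0)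
           \<longrightarrow> \<epsilon> * l2norm x \<le> l2norm (tri a d x)"
proof (rule ccontr)
  assume neg: "\<not> ?thesis"
  let ?T = "tri a d"
  \<comment> \<open>Violators of the lower bound, normalised. Enlarging the outer radius to at least
    \<open>R + 1\<close> is harmless and lets the radii increase in the construction below.\<close>
  have ex: "\<exists>x N. (\<forall>i. \<bar>i\<bar> > N \<or> \<bar>i\<bar> \<le> R \<longrightarrow> x i = 0) \<and> N > R \<and> l2norm x = 1 \<and> l2norm (?T x) \<le> \<epsilon>"
    if "\<epsilon> > 0" for \<epsilon> and R :: int
  proof -
    obtain x N where x: "\<And>i. \<bar>i\<bar> > N \<or> \<bar>i\<bar> \<le> R \<Longrightarrow> x i = 0" and lt: "l2norm (?T x) < \<epsilon> * l2norm x"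
      using neg \<open>\<epsilon> > 0\<close> unfolding not_ex not_all not_imp not_le de_Morgan_conj by metis
    have pos: "l2norm x > 0"
      using le_less_trans[OF l2norm_nonneg lt] \<open>\<epsilon> > 0\<close> by (simp add: zero_less_mult_iff)
    define c where "c = complex_of_real (1 / l2norm x)"
    have "l2norm (\<lambda>i. c * x i) = 1" unfolding l2norm_cmult using pos by (simp add: c_def norm_divide)
    moreover have "l2norm (?T (\<lambda>i. c * x i)) \<le> \<epsilon>"
      unfolding tri_cmult[abs_def] l2norm_cmult using pos lt
      by (simp add: c_def norm_divide divide_le_eq)
    moreover have "\<forall>i. \<bar>i\<bar> > max N (R + 1) \<or> \<bar>i\<bar> \<le> R \<longrightarrow> c * x i = 0" using x by simp
    moreover have "max N (R + 1) > R" by simp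
    ultimately show ?thesis
      by (intro exI[of _ "\<lambda>i. c * x i"] exI[of _ "max N (R + 1)"] conjI)
  qed
  \<comment> \<open>A state is a vector with a radius bounding its support. The \<open>n\<close>-th
    vector also vanishes up to distance \<open>n\<close>, which makes formal series in these vectors
    locally finite.\<close>
  define P where "P n s \<longleftrightarrow> (\<forall>i. \<bar>i\<bar> > snd s \<or> \<bar>i\<bar> \<le> int n \<longrightarrow> fst s i = 0) \<and>
      l2norm (fst s) = 1 \<and> l2norm (?T (fst s)) \<le> (1/2) ^ n"
    for n and s :: "(int \<Rightarrow> complex) \<times> int"
  \<comment> \<open>Each vector starts outside the radius of its predecessor; with increasing radii
    this makes all supports disjoint.\<close>
  define Q where "Q s t \<longleftrightarrow> snd s \<le> snd t \<and> (\<forall>i. \<bar>i\<bar> \<le> snd s \<longrightarrow> fst t i = 0)"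
    for s t :: "(int \<Rightarrow> complex) \<times> int"
  have "\<exists>f. \<forall>n. P n (f n) \<and> Q (f n) (f (Suc n))"
  proof (rule dependent_nat_choice)
    obtain x N where "\<forall>i. \<bar>i\<bar> > N \<or> \<bar>i\<bar> \<le> 0 \<longrightarrow> x i = 0" "l2norm x = 1" "l2norm (?T x) \<le> 1"
      using ex[OF zero_less_one, of 0] by blast
    then have "P 0 (x, N)" by (simp add: P_def)
    then show "\<exists>s. P 0 s" ..
  next
    fix s :: "(int \<Rightarrow> complex) \<times> int" and n
    have "(0::real) < (1/2) ^ Suc n" by simp
    from ex[OF this, of "max (snd s) (int (Suc n))"]
    obtain x N where "\<forall>i. \<bar>i\<bar> > N \<or> \<bar>i\<bar> \<le> max (snd s) (int (Suc n)) \<longrightarrow> x i = 0"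
      "N > max (snd s) (int (Suc n))" "l2norm x = 1" "l2norm (?T x) \<le> (1/2) ^ Suc n"
      by blast
    then have "P (Suc n) (x, N) \<and> Q s (x, N)" by (simp add: P_def Q_def)
    then show "\<exists>t. P (Suc n) t \<and> Q s t" ..
  qed
  then obtain f where Pf: "\<And>n. P n (f n)" and Qf: "\<And>n. Q (f n) (f (Suc n))" by blast
  define x R where "x n = fst (f n)" and "R n = snd (f n)" for n
  have xR: "x n i = 0" if "\<bar>i\<bar> > R n \<or> \<bar>i\<bar> \<le> int n" for n i
    using Pf that by (auto simp: P_def x_def R_def)
  have x1: "l2norm (x n) = 1" and Tx: "l2norm (?T (x n)) \<le> (1/2) ^ n" for n
    using Pf by (auto simp: P_def x_def)
  have xl2: "x n \<in> l2 UNIV" for n by (rule l2_finite_support[of "R n"]) (use xR in auto)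
  have "incseq R" using Qf by (auto intro: incseq_SucI simp: Q_def R_def)
  have disj': "x m i = 0 \<or> x n i = 0" if "m < n" for m n i
  proof (cases n)
    case (Suc n')
    then have "R m \<le> R n'" using that incseqD[OF \<open>incseq R\<close>, of m n'] by simp
    moreover have "x n i = 0" if "\<bar>i\<bar> \<le> R n'" using Qf[of n'] that Suc by (auto simp: Q_def x_def R_def)
    ultimately show ?thesis using xR[of m i] by force
  qed (use that in auto)
  then have disj: "x m i = 0 \<or> x n i = 0" if "m \<noteq> n" for m n i
    using that by (metis nat_neq_iff)
  \<comment> \<open>The full series: at site \<open>i\<close> the terms with \<open>n\<close> at
    least \<open>\<bar>i\<bar>\<close> vanish, so the truncation loses nothing.\<close>
  define X where "X c i = (\<Sum>n<nat \<bar>i\<bar>. c n * x n i)" for c i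
  define S where "S c N i = (\<Sum>n<N. c n * x n i)" for c N and i :: int
  have S_single: "S c N i = (if n < N then c n * x n i else 0)" if "x n i \<noteq> 0" for c N n i
  proof -
    have "c m * x m i = (if m = n then c n * x n i else 0)" for m using disj[of m n i] that by auto
    then show ?thesis unfolding S_def by (simp add: sum.delta)
  qed
  have SX: "S c N i = X c i" if "N \<ge> nat \<bar>i\<bar>" for c N i
    unfolding S_def X_def using that by (intro sum.mono_neutral_right) (auto intro!: xR)
  have S_le: "cmod (S c N i) \<le> cmod (X c i)" for c N i
  proof (cases "\<exists>n. x n i \<noteq> 0")
    case True
    then obtain n where n: "x n i \<noteq> 0" by blast
    then have "\<not> \<bar>i\<bar> \<le> int n" using xR by blast
    then have "n < nat \<bar>i\<bar>" by simp
    then show ?thesis using S_single[OF n] SX[of i "nat \<bar>i\<bar>" c] by simp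
  qed (simp add: S_def)
  have Sl2: "S c N \<in> l2 UNIV" for c N
    unfolding S_def by (intro l2_sum l2_cmult xl2)
  have S_Suc: "S c (Suc N) = (\<lambda>i. S c N i + c N * x N i)" for c N
    by (simp add: S_def fun_eq_iff)
  have S_norm: "(l2norm (S c N))\<^sup>2 = (\<Sum>n<N. (cmod (c n))\<^sup>2)" for c N
  proof (induction N)
    case 0 then show ?case by (simp add: S_def)
  next
    case (Suc N)
    have "S c N i = 0 \<or> c N * x N i = 0" for i
      using S_single[of N i c N] by auto
    from l2norm_sq_disjoint_add[OF Sl2 l2_cmult[OF xl2] this] show ?case
      by (simp add: S_Suc Suc l2norm_cmult x1)
  qed
  \<comment> \<open>The vectors are orthonormal, so the squared moduli of the coefficients have
    partial sums bounded by the squared norm of \<open>X c\<close>.\<close>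
  have not_l2: "(\<lambda>n. (cmod (c n))\<^sup>2) \<longlonglongrightarrow> 0" if "X c \<in> l2 UNIV" for c
  proof -
    have "l2norm (S c N) \<le> l2norm (X c)" for N
      using l2_mult_bounded(2)[OF that, of "S c N" 1] S_le by simp
    then have "(\<Sum>n<N. (cmod (c n))\<^sup>2) \<le> (l2norm (X c))\<^sup>2" for N
      unfolding S_norm[symmetric] by (intro power_mono) auto
    then have "summable (\<lambda>n. (cmod (c n))\<^sup>2)"
      by (intro summableI_nonneg_bounded) auto
    then show ?thesis by (rule summable_LIMSEQ_zero)
  qed
  \<comment> \<open>The images of the partial sums converge in norm to \<open>y\<close>, which
    therefore lies in the closure of the range; coordinatewise they converge to
    \<open>T (X c)\<close>, even if \<open>X c\<close> is not in l2.\<close>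
  have solve: "\<exists>z\<in>l2 UNIV. ?T z = ?T (X c)" if c: "\<And>n. cmod (c n) \<le> 1" for c
  proof -
    have "l2norm (\<lambda>i. ?T (S c (Suc N)) i - ?T (S c N) i) \<le> 1 * (1/2) ^ N" for N
    proof -
      have "(\<lambda>i. ?T (S c (Suc N)) i - ?T (S c N) i) = (\<lambda>i. c N * ?T (x N) i)"
        unfolding S_Suc by (simp add: tri_add tri_cmult)
      then have "l2norm (\<lambda>i. ?T (S c (Suc N)) i - ?T (S c N) i) = cmod (c N) * l2norm (?T (x N))"
        by (simp add: l2norm_cmult)
      also have "\<dots> \<le> 1 * (1/2) ^ N" by (intro mult_mono c Tx) auto
      finally show ?thesis .
    qed
    with l2_geometric_Cauchy[of "\<lambda>N. ?T (S c N)" UNIV "1/2" 1] tri_bounded(1)[of a K d, OF a d Sl2]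
    obtain y where y: "y \<in> l2 UNIV" "\<And>i. (\<lambda>N. ?T (S c N) i) \<longlonglongrightarrow> y i"
      "\<And>N. l2norm (\<lambda>i. y i - ?T (S c N) i) \<le> 1 * (1/2) ^ N / (1 - 1/2)" by auto
    have "(\<lambda>N. S c N i) \<longlonglongrightarrow> X c i" for i
      by (rule tendsto_eventually) (use SX[of i] in \<open>auto simp: eventually_sequentially\<close>)
    then have "?T (X c) i = y i" for i
      using LIMSEQ_unique[OF tri_tendsto y(2)] by blast
    then have yX: "y = ?T (X c)" by (simp add: fun_eq_iff)
    have "\<exists>x\<in>l2 UNIV. ?T x = y"
    proof (rule closed[OF y(1)])
      fix \<epsilon> :: real assume "\<epsilon> > 0"
      then obtain N where "(1/2) ^ N < \<epsilon> / 2"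
        using real_arch_pow_inv[of "\<epsilon> / 2" "1/2"] by auto
      then have "l2norm (\<lambda>i. ?T (S c N) i - y i) < \<epsilon>"
        using y(3)[of N] by (subst l2norm_minus_commute) simp
      then show "\<exists>x\<in>l2 UNIV. l2norm (\<lambda>i. ?T x i - y i) < \<epsilon>" using Sl2 by blast
    qed
    then show ?thesis using yX by simp
  qed
  define e where "e k n = (if n mod 3 = k then 1 else 0 :: complex)" for k n :: nat
  have "\<exists>z\<in>l2 UNIV. ?T z = ?T (X (e k))" for k
    by (rule solve) (simp add: e_def)
  then obtain z where z: "\<And>k. z k \<in> l2 UNIV" "\<And>k. ?T (z k) = ?T (X (e k))" by metis
  define g where "g k i = X (e k) i - z k i" for k i
  \<comment> \<open>The formal solutions \<open>g k\<close> are recorded by their values at 0 and 1.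
    A combination that vanishes at both sites vanishes everywhere, so the same combination of the
    \<open>X (e k)\<close> lies in l2.\<close>
  obtain \<gamma> k where \<gamma>: "k < 3" "\<gamma> k \<noteq> 0" "(\<Sum>k<3. \<gamma> k * g k 0) = 0" "(\<Sum>k<3. \<gamma> k * g k 1) = 0"
    using three_pairs_dependent[of "\<lambda>k. g k 0" "\<lambda>k. g k 1"] by blast
  have "?T (g k) i = 0" for k i
    unfolding g_def tri_diff using z(2)[of k] by (simp add: fun_eq_iff)
  then have "?T (\<lambda>i. \<Sum>k<3. \<gamma> k * g k i) i = 0" for i
    unfolding tri_sum tri_cmult by simp
  from tri_kernel_determined[OF a0 this \<gamma>(3,4)]
  have sol: "(\<Sum>k<3. \<gamma> k * X (e k) i) = (\<Sum>k<3. \<gamma> k * z k i)" for i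
    by (simp add: g_def algebra_simps sum_subtractf)
  define c where "c n = \<gamma> (n mod 3)" for n :: nat
  have ce: "c n = (\<Sum>k<3. \<gamma> k * e k n)" for n
  proof -
    have "\<gamma> k * e k n = (if k = n mod 3 then \<gamma> (n mod 3) else 0)" for k by (simp add: e_def)
    then show ?thesis by (simp add: c_def)
  qed
  have "X c i = (\<Sum>k<3. \<gamma> k * X (e k) i)" for i
    unfolding X_def ce sum_distrib_right sum_distrib_left
    by (subst sum.swap) (simp add: mult.assoc)
  then have "X c = (\<lambda>i. \<Sum>k<3. \<gamma> k * z k i)" by (simp add: sol fun_eq_iff)
  then have "X c \<in> l2 UNIV" by (simp add: l2_sum l2_cmult z)
  \<comment> \<open>The combined coefficient sequence is periodic and equals the non-zero
    \<open>\<gamma> k\<close> along \<open>3 * m + k\<close>, yet membership in l2 forces it to tend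
    to 0.\<close>
  from LIMSEQ_subseq_LIMSEQ[OF not_l2[OF this], of "\<lambda>m. 3 * m + k"]
  have "(\<lambda>m::nat. (cmod (\<gamma> k))\<^sup>2) \<longlonglongrightarrow> 0"
    using \<gamma>(1) by (auto simp: strict_mono_def c_def o_def)
  then show False using \<gamma>(2) by (simp add: LIMSEQ_const_iff)
qed

section \<open>Concatenation of blocks\<close>

text \<open>Signed index of the first entry of block \<open>j\<close>; for negative \<open>j\<close>
  it counts the lengths of the blocks from \<open>j\<close> up to -1.\<close>

definition bpos :: "(int \<Rightarrow> 'a list) \<Rightarrow> int \<Rightarrow> int" where
  "bpos L j = (if 0 \<le> j then int (block_pos (\<lambda>k. L (int k)) (nat j))
               else - int (block_pos (\<lambda>k. L (- 1 - int k)) (nat (- j))))"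

definition flatZ :: "(int \<Rightarrow> 'a list) \<Rightarrow> int \<Rightarrow> 'a" where
  "flatZ L i = (if 0 \<le> i then flat (\<lambda>k. L (int k)) (nat i)
                else flat (\<lambda>k. rev (L (- 1 - int k))) (nat (- i - 1)))"

lemma res_Z_eq_flatZ: "res_Z B chi = flatZ (\<lambda>j. B (chi j))"
  by (simp add: fun_eq_iff res_Z_def flatZ_def)

text \<open>The two half-line arrangements together form one ordinary two-sided concatenation, with
  block sequence reflected by \<open>- 1 - j\<close>. Bulk results thus apply to it.\<close>

lemma res_half_eq_flatZ:
  "res_half B chi = flatZ (\<lambda>j. B (chi (if 0 \<le> j then nat j else nat (- 1 - j))))"
  by (simp add: fun_eq_iff res_half_def flatZ_def)

lemma block_pos_Suc: "block_pos L (Suc k) = block_pos L k + length (L k)"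
  by (simp add: block_pos_def)

lemma block_pos_mono: "k \<le> k' \<Longrightarrow> block_pos L k \<le> block_pos L k'"
  unfolding block_pos_def by (rule sum_mono2) auto

lemma flat_block_pos:
  assumes "m < length (L k)"
  shows "flat L (block_pos L k + m) = L k ! m"
proof -
  let ?n = "block_pos L k + m"
  have "(THE k. block_pos L k \<le> ?n \<and> ?n < block_pos L (Suc k)) = k"
  proof (rule the_equality)
    show "block_pos L k \<le> ?n \<and> ?n < block_pos L (Suc k)" using assms by (simp add: block_pos_Suc)
    fix k' assume k': "block_pos L k' \<le> ?n \<and> ?n < block_pos L (Suc k')"
    show "k' = k"
    proof (rule ccontr)
      assume "k' \<noteq> k"
      then have "Suc k' \<le> k \<or> Suc k \<le> k'" by linarith
      then show False
        using block_pos_mono[of "Suc k'" k L] block_pos_mono[of "Suc k" k' L] k' assms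
        by (auto simp: block_pos_Suc)
    qed
  qed
  then show ?thesis by (simp add: flat_def)
qed

lemma bpos_0 [simp]: "bpos L 0 = 0"
  by (simp add: bpos_def block_pos_def)

lemma bpos_Suc: "bpos L (j + 1) = bpos L j + int (length (L j))"
proof (cases "0 \<le> j")
  case True
  then have "nat (j + 1) = Suc (nat j)" by simp
  then show ?thesis using True by (simp add: bpos_def block_pos_Suc)
next
  case False
  then have n: "nat (- j) = Suc (nat (- j - 1))" and j: "- 1 - int (nat (- j - 1)) = j" by simp_all
  show ?thesis
  proof (cases "j = - 1")
    case True
    then show ?thesis by (simp add: bpos_def block_pos_def)
  next
    case False
    with \<open>\<not> 0 \<le> j\<close> have "\<not> 0 \<le> j + 1" "nat (- (j + 1)) = nat (- j - 1)" by simp_all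
    then show ?thesis using \<open>\<not> 0 \<le> j\<close> j unfolding bpos_def n by (simp add: block_pos_Suc)
  qed
qed

text \<open>On the negative side each block is stored reversed and also read right to left; the two
  reversals cancel, so one formula serves both sides.\<close>

lemma flatZ_bpos:
  assumes "m < length (L j)"
  shows "flatZ L (bpos L j + int m) = L j ! m"
proof (cases "0 \<le> j")
  case True
  let ?b = "block_pos (\<lambda>k. L (int k)) (nat j)"
  have "nat (bpos L j + int m) = ?b + m" using True by (simp add: bpos_def nat_add_distrib)
  moreover have "0 \<le> bpos L j + int m" using True by (simp add: bpos_def)
  ultimately show ?thesis
    using flat_block_pos[of m "\<lambda>k. L (int k)" "nat j"] assms True by (simp add: flatZ_def)
next
  case False
  define k where "k = nat (- j - 1)"
  define P where "P = block_pos (\<lambda>k. rev (L (- 1 - int k)))"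
  have j: "- 1 - int k = j" "nat (- j) = Suc k" using False by (simp_all add: k_def)
  have Peq: "block_pos (\<lambda>k. L (- 1 - int k)) n = P n" for n by (simp add: P_def block_pos_def)
  have "bpos L j = - int (P k + length (L j))"
    using False by (simp add: bpos_def Peq j) (simp add: P_def block_pos_Suc j)
  then have "bpos L j + int m < 0" "nat (- (bpos L j + int m) - 1) = P k + (length (L j) - 1 - m)"
    using assms by linarith+
  moreover have "flat (\<lambda>k. rev (L (- 1 - int k))) (P k + (length (L j) - 1 - m)) = L j ! m"
    unfolding P_def using assms j by (subst flat_block_pos) (auto simp: rev_nth)
  ultimately show ?thesis by (simp add: flatZ_def)
qed

lemma bpos_cover:
  assumes "0 \<le> t" "t < bpos L (j + int n) - bpos L j"
  shows "\<exists>k m. k < n \<and> m < length (L (j + int k)) \<and> bpos L j + t = bpos L (j + int k) + int m"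
  using assms(2)
proof (induction n)
  case 0
  then show ?case using assms(1) by simp
next
  case (Suc n)
  show ?case
  proof (cases "t < bpos L (j + int n) - bpos L j")
    case True
    then show ?thesis using Suc.IH less_SucI by blast
  next
    case False
    have "t < bpos L (j + int n) + int (length (L (j + int n))) - bpos L j"
      using Suc.prems bpos_Suc[of L "j + int n"] by (simp add: algebra_simps)
    then show ?thesis using False
      by (intro exI[of _ n] exI[of _ "nat (t - (bpos L (j + int n) - bpos L j))"]) auto
  qed
qed

text \<open>Every block contributes at least one resonator, so distances counted in blocks bound
  distances counted in resonators from below.\<close>

lemma bpos_diff_ge:
  assumes "\<And>j. L j \<noteq> []"
  shows "bpos L j + int n \<le> bpos L (j + int n)"
proof (induction n)
  case (Suc n)
  have "length (L (j + int n)) \<ge> 1" using assms by (simp add: Suc_le_eq)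
  then show ?case using Suc bpos_Suc[of L "j + int n"] by (simp add: algebra_simps)
qed simp

lemma bpos_ge: "(\<And>j. L j \<noteq> []) \<Longrightarrow> 0 \<le> j \<Longrightarrow> j \<le> bpos L j"
  using bpos_diff_ge[of L 0 "nat j"] by simp

lemma bpos_le: "(\<And>j. L j \<noteq> []) \<Longrightarrow> j \<le> 0 \<Longrightarrow> bpos L j \<le> j"
  using bpos_diff_ge[of L j "nat (- j)"] by simp

lemma flatZ_in_blocks:
  assumes "\<And>j. L j \<noteq> []"
  shows "\<exists>j. flatZ L i \<in> set (L j)"
proof -
  define N where "N = nat \<bar>i\<bar> + 1"
  have lo: "bpos L (- int N) \<le> - int N" and hi: "int N \<le> bpos L (- int N + int (2 * N))"
    using bpos_le[of L "- int N", OF assms] bpos_ge[of L "int N", OF assms] by simp_all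
  have i: "- int N \<le> i" "i < int N" by (auto simp: N_def)
  obtain k m where "m < length (L (- int N + int k))"
    "bpos L (- int N) + (i - bpos L (- int N)) = bpos L (- int N + int k) + int m"
    using bpos_cover[of "i - bpos L (- int N)" L "- int N" "2 * N"] lo hi i by auto
  then show ?thesis
    using flatZ_bpos[of m L "- int N + int k"] by (metis add_diff_cancel_left' add_diff_eq nth_mem)
qed

text \<open>Relative positions inside a window depend only on the lengths of the blocks in it. The
  second conclusion keeps a window lying to the left of the origin away from it.\<close>

lemma flatZ_window:
  assumes eq: "\<And>k. k < n \<Longrightarrow> L' (j' + int k) = L (j + int k)"
    and t: "0 \<le> t" "t < bpos L (j + int n) - bpos L j"
  shows "flatZ L' (bpos L' j' + t) = flatZ L (bpos L j + t)"
    and "bpos L' j' + t < bpos L' (j' + int n)"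
proof -
  have d: "bpos L' (j' + int k) - bpos L' j' = bpos L (j + int k) - bpos L j" if "k \<le> n" for k
    using that
  proof (induction k)
    case (Suc k)
    then show ?case
      using bpos_Suc[of L' "j' + int k"] bpos_Suc[of L "j + int k"] eq[of k] by (simp add: algebra_simps)
  qed simp
  obtain k m where k: "k < n" "m < length (L (j + int k))" "bpos L j + t = bpos L (j + int k) + int m"
    using bpos_cover[OF t] by blast
  then have "bpos L' j' + t = bpos L' (j' + int k) + int m" using d[of k] by simp
  then show "flatZ L' (bpos L' j' + t) = flatZ L (bpos L j + t)"
    using k eq by (simp add: flatZ_bpos)
  show "bpos L' j' + t < bpos L' (j' + int n)" using d[of n] t by simp
qed

section \<open>Distant copies of finite windows\<close>

lemma pseudo_ergodic_far:
  assumes pe: "pseudo_ergodic D chi" and D: "1 \<le> D" and w: "set w \<subseteq> {1..D}"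
  shows "\<exists>j. (\<forall>m<length w. chi (j + int m) = w ! m) \<and> (int R \<le> j \<or> j + int (length w) \<le> - int R)"
proof -
  \<comment> \<open>Two copies of \<open>w\<close> separated by \<open>2 * R\<close> letters: if the
    left copy does not end at or before \<open>-R\<close>, the right copy starts beyond
    \<open>R\<close>.\<close>
  define W where "W = w @ replicate (2 * R) 1 @ w"
  have "set W \<subseteq> {1..D}" using w D by (auto simp: W_def)
  then obtain j where j: "\<And>m. m < length W \<Longrightarrow> chi (j + int m) = W ! m"
    using pe unfolding pseudo_ergodic_def by blast
  let ?j = "j + int (length w + 2 * R)"
  have 1: "chi (j + int m) = w ! m" if "m < length w" for m
    using j[of m] that by (simp add: W_def nth_append)
  have 2: "chi (?j + int m) = w ! m" if "m < length w" for m
    using j[of "length w + 2 * R + m"] that by (simp add: W_def nth_append add.assoc)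
  show ?thesis
  proof (cases "j + int (length w) \<le> - int R")
    case True
    then show ?thesis using 1 by blast
  next
    case False
    then have "int R \<le> ?j" by simp
    then show ?thesis using 2 by blast
  qed
qed

lemma pseudo_ergodic_far_copy:
  fixes L :: "nat \<Rightarrow> 'a list"
  assumes pe: "pseudo_ergodic D chi'" and D: "1 \<le> D" and ne: "\<And>d. d \<in> {1..D} \<Longrightarrow> L d \<noteq> []"
    and chi': "\<And>j. chi' j \<in> {1..D}" and chi: "\<And>j. chi j \<in> {1..D}"
  shows "\<exists>p. \<forall>i. \<bar>i\<bar> \<le> int N \<longrightarrow>
           flatZ (\<lambda>j. L (chi' j)) (p + i) = flatZ (\<lambda>j. L (chi j)) i \<and> int R < \<bar>p + i\<bar>"
proof -
  let ?L = "\<lambda>j. L (chi j)" and ?L' = "\<lambda>j. L (chi' j)"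
  have ne: "?L j \<noteq> []" "?L' j \<noteq> []" for j using ne chi chi' by auto
  \<comment> \<open>As blocks are non-empty, \<open>N + 1\<close> of them on each side of the origin
    cover all sites up to distance \<open>N\<close>.\<close>
  define K where "K = N + 1"
  define w where "w = map (\<lambda>k. chi (- int K + int k)) [0..<2 * K]"
  have lw: "length w = 2 * K" by (simp add: w_def)
  have "set w \<subseteq> {1..D}" using chi by (auto simp: w_def)
  from pseudo_ergodic_far[OF pe D this, of "R + 1"] obtain j where
    j: "\<And>m. m < 2 * K \<Longrightarrow> chi' (j + int m) = w ! m"
    and far: "int (R + 1) \<le> j \<or> j + int (2 * K) \<le> - int (R + 1)" unfolding lw by blast
  have eq: "?L' (j + int k) = ?L (- int K + int k)" if "k < 2 * K" for k
    using j[OF that] that by (simp add: w_def)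
  have lo: "bpos ?L (- int K) \<le> - int K" and hi: "int K \<le> bpos ?L (- int K + int (2 * K))"
    using bpos_le[of ?L "- int K", OF ne(1)] bpos_ge[of ?L "int K", OF ne(1)] by simp_all
  \<comment> \<open>This offset aligns the first resonator of the window with that of its
    copy.\<close>
  define p where "p = bpos ?L' j - bpos ?L (- int K)"
  have "flatZ ?L' (p + i) = flatZ ?L i \<and> int R < \<bar>p + i\<bar>" if "\<bar>i\<bar> \<le> int N" for i
  proof -
    define t where "t = i - bpos ?L (- int K)"
    have t: "0 \<le> t" "t < bpos ?L (- int K + int (2 * K)) - bpos ?L (- int K)"
      using lo hi that by (auto simp: t_def K_def)
    have pi: "p + i = bpos ?L' j + t" "i = bpos ?L (- int K) + t" by (simp_all add: p_def t_def)
    note W = flatZ_window[of "2 * K" ?L' j ?L "- int K", OF eq t]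
    have "int R < \<bar>p + i\<bar>"
      using far
    proof
      assume "int (R + 1) \<le> j"
      then show ?thesis using bpos_ge[of ?L' j, OF ne(2)] t(1) pi(1) by simp
    next
      assume *: "j + int (2 * K) \<le> - int (R + 1)"
      then show ?thesis using bpos_le[of ?L' "j + int (2 * K)", OF ne(2)] W(2) pi(1) by simp
    qed
    moreover have "flatZ ?L' (p + i) = flatZ ?L i"
      unfolding pi(1) using W(1) pi(2) by simp
    ultimately show ?thesis by blast
  qed
  then show ?thesis by blast
qed

section \<open>Limit operators\<close>

lemma l2_finite_approximation:
  assumes x: "x \<in> l2 UNIV" and \<delta>: "\<delta> > 0"
  obtains y and N :: nat where "\<And>i. \<bar>i\<bar> > int N \<Longrightarrow> y i = 0" "l2norm (\<lambda>i. x i - y i) \<le> \<delta>"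
proof -
  let ?f = "\<lambda>i. (cmod (x i))\<^sup>2"
  have s: "?f summable_on UNIV" using x by (simp add: l2_def)
  obtain F where F: "finite F" "dist (sum ?f F) (infsum ?f UNIV) \<le> \<delta>\<^sup>2"
    using infsum_finite_approximation[OF s, of "\<delta>\<^sup>2"] \<delta> by auto
  define y where "y i = (if i \<in> F then x i else 0)" for i
  have "finite (abs ` F)" using F by simp
  from bdd_above_finite[OF this] obtain M where M: "\<And>i. i \<in> F \<Longrightarrow> \<bar>i\<bar> \<le> M"
    unfolding bdd_above_def by blast
  define N where "N = nat M"
  have yN: "y i = 0" if "\<bar>i\<bar> > int N" for i using M[of i] that by (auto simp: y_def N_def split: if_splits)
  have y: "y \<in> l2 UNIV" by (rule l2_finite_support[OF yN])
  have xy: "(\<lambda>i. x i - y i) \<in> l2 UNIV" by (rule l2_diff(1)[OF x y])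
  have "(l2norm (\<lambda>i. (x i - y i) + y i))\<^sup>2 = (l2norm (\<lambda>i. x i - y i))\<^sup>2 + (l2norm y)\<^sup>2"
    by (rule l2norm_sq_disjoint_add[OF xy y]) (simp add: y_def)
  moreover have "(l2norm y)\<^sup>2 = sum ?f F"
  proof -
    have "infsum (\<lambda>i. (cmod (y i))\<^sup>2) UNIV = infsum ?f F"
      by (rule infsum_cong_neutral) (auto simp: y_def)
    then show ?thesis using F by (simp add: l2norm_sq)
  qed
  ultimately have "(l2norm (\<lambda>i. x i - y i))\<^sup>2 = infsum ?f UNIV - sum ?f F"
    by (simp add: l2norm_sq[of x])
  also have "\<dots> \<le> \<delta>\<^sup>2" using F(2) by (simp add: dist_real_def)
  finally have "l2norm (\<lambda>i. x i - y i) \<le> \<delta>" using \<delta> by (simp add: power2_le_iff_abs_le)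
  with yN that show thesis by blast
qed

lemma tri_bounded_below_from_finite_support:
  assumes a: "\<And>i. \<bar>a i\<bar> \<le> K" and d: "\<And>i. \<bar>d i\<bar> \<le> K" and \<epsilon>: "\<epsilon> > 0"
    and below: "\<And>x (N::nat). (\<And>i. \<bar>i\<bar> > int N \<Longrightarrow> x i = 0) \<Longrightarrow> \<epsilon> * l2norm x \<le> l2norm (tri a d x)"
    and x: "x \<in> l2 UNIV"
  shows "\<epsilon> * l2norm x \<le> l2norm (tri a d x)"
proof (rule field_le_epsilon)
  fix \<eta> :: real assume \<eta>: "\<eta> > 0"
  have K: "K \<ge> 0" using a[of 0] by linarith
  \<comment> \<open>The approximation error enters once through \<open>\<epsilon>\<close> and once
    through the operator norm bound \<open>3 * K\<close>; this choice makes the total equal to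
    \<open>\<eta>\<close>.\<close>
  define \<delta> where "\<delta> = \<eta> / (3 * K + \<epsilon>)"
  have \<delta>: "\<delta> > 0" "(3 * K + \<epsilon>) * \<delta> = \<eta>" using K \<epsilon> \<eta> by (auto simp: \<delta>_def)
  obtain y N where y: "\<And>i. \<bar>i\<bar> > int N \<Longrightarrow> y i = 0" and xy: "l2norm (\<lambda>i. x i - y i) \<le> \<delta>"
    using l2_finite_approximation[OF x \<delta>(1)] by metis
  have yl: "y \<in> l2 UNIV" by (rule l2_finite_support[OF y])
  have e: "(\<lambda>i. x i - y i) \<in> l2 UNIV" by (rule l2_diff(1)[OF x yl])
  have "l2norm x \<le> l2norm (\<lambda>i. x i - y i) + l2norm y" using l2_add(2)[OF e yl] by simp
  then have "\<epsilon> * l2norm x \<le> \<epsilon> * (\<delta> + l2norm y)" using \<epsilon> xy by (intro mult_left_mono) auto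
  also have "\<dots> \<le> \<epsilon> * \<delta> + l2norm (tri a d y)" using below[OF y] by (simp add: algebra_simps)
  also have "l2norm (tri a d y) \<le> l2norm (tri a d x) + l2norm (tri a d (\<lambda>i. x i - y i))"
    using l2_diff(2)[OF tri_bounded(1)[of a K d, OF a d x] tri_bounded(1)[of a K d, OF a d e]]
    by (simp add: tri_diff)
  also have "l2norm (tri a d (\<lambda>i. x i - y i)) \<le> 3 * K * \<delta>"
    using tri_bounded(2)[of a K d, OF a d e] mult_left_mono[OF xy, of "3 * K"] K by simp
  finally show "\<epsilon> * l2norm x \<le> l2norm (tri a d x) + \<eta>"
    using \<delta>(2) by (simp add: algebra_simps)
qed

text \<open>Agreement is required one site beyond the support because \<open>a (- N - 1)\<close>
  couples row \<open>- N - 1\<close> to the entry at \<open>- N\<close>.\<close>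

lemma tri_translate:
  assumes x: "\<And>i. \<bar>i\<bar> > N \<Longrightarrow> x i = 0"
    and eq: "\<And>i. \<bar>i\<bar> \<le> N + 1 \<Longrightarrow> a' (p + i) = a i \<and> d' (p + i) = d i"
  shows "tri a' d' (\<lambda>i. x (i - p)) = (\<lambda>i. tri a d x (i - p))"
proof
  fix i
  define m where "m = i - p"
  have i: "i = p + m" by (simp add: m_def)
  have "a' (p + (m - 1)) *\<^sub>R x (m - 1) = a (m - 1) *\<^sub>R x (m - 1)"
    using x[of "m - 1"] eq[of "m - 1"] by (cases "\<bar>m - 1\<bar> > N") auto
  moreover have "a' (p + m) *\<^sub>R x (m + 1) = a m *\<^sub>R x (m + 1)"
    using x[of "m + 1"] eq[of m] by (cases "\<bar>m + 1\<bar> > N") auto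
  moreover have "d' (p + m) *\<^sub>R x m = d m *\<^sub>R x m"
    using x[of m] eq[of m] by (cases "\<bar>m\<bar> > N") auto
  moreover have e: "p + m - 1 = p + (m - 1)" "p + (m - 1) - p = m - 1" "p + m + 1 - p = m + 1" "p + m - p = m"
    by simp_all
  ultimately show "tri a' d' (\<lambda>i. x (i - p)) i = tri a d x (i - p)"
    unfolding i tri_def e by (simp only:)
qed

lemma op_shift_jac_eq_tri: "op_shift (jac r) lam = tri (coef_a r) (\<lambda>i. coef_b r i - lam)"
  by (auto simp: fun_eq_iff op_shift_def jac_def tri_def scaleR_conv_of_real algebra_simps)

text \<open>Coefficients depend on pairs of neighbouring resonators, of which there are finitely
  many.\<close>

lemma coef_bounded:
  assumes "finite A" "\<And>i. r i \<in> A"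
  shows "\<exists>K. \<forall>i. \<bar>coef_a r i\<bar> \<le> K \<and> \<bar>coef_b r i - lam\<bar> \<le> K"
proof -
  let ?f = "\<lambda>(u, w). \<bar>- (res_v u * res_v w) / (res_s u * sqrt (res_l u * res_l w))\<bar>"
  let ?g = "\<lambda>(u, w). \<bar>(res_v w)\<^sup>2 / res_l w * (1 / res_s u + 1 / res_s w) - lam\<bar>"
  have "finite (?f ` (A \<times> A) \<union> ?g ` (A \<times> A))" using assms(1) by blast
  from bdd_above_finite[OF this] obtain K where K: "\<forall>z\<in>?f ` (A \<times> A) \<union> ?g ` (A \<times> A). z \<le> K"
    unfolding bdd_above_def ..
  have "\<bar>coef_a r i\<bar> \<le> K" for i
    by (rule bspec[OF K], rule UnI1, rule image_eqI[where x="(r i, r (i + 1))"])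
       (use assms(2) in \<open>auto simp: coef_a_def\<close>)
  moreover have "\<bar>coef_b r i - lam\<bar> \<le> K" for i
    by (rule bspec[OF K], rule UnI2, rule image_eqI[where x="(r (i - 1), r i)"])
       (use assms(2) in \<open>auto simp: coef_b_def\<close>)
  ultimately show ?thesis by blast
qed

lemma coef_a_nonzero:
  assumes "\<And>i. res_v (r i) > 0 \<and> res_l (r i) > 0 \<and> res_s (r i) > 0"
  shows "coef_a r i \<noteq> 0"
  using assms[of i] assms[of "i + 1"] by (auto simp: coef_a_def)

text \<open>A finitely supported vector is moved to a distant copy of its surroundings inside
  \<open>chi'\<close>, where the closed range gives a lower bound; translation preserves both norms,
  and density removes the support condition.\<close>

lemma fredholm_imp_bounded_below_all:
  fixes B :: "nat \<Rightarrow> resonator list"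
  assumes blocks: "valid_blocks D B" and chi': "\<And>j. chi' j \<in> {1..D}" and pe: "pseudo_ergodic D chi'"
    and fr: "fredholm_on (l2 UNIV) (op_shift (jac (res_Z B chi')) lam)"
    and chi: "\<And>j::int. chi j \<in> {1..D}"
  shows "\<exists>\<epsilon>>0. \<forall>x\<in>l2 UNIV. \<epsilon> * l2norm x \<le> l2norm (op_shift (jac (flatZ (\<lambda>j. B (chi j)))) lam x)"
proof -
  define A where "A = (\<Union>d\<in>{1..D}. set (B d))"
  have A: "finite A" by (simp add: A_def)
  have D: "1 \<le> D" using chi'[of 0] by simp
  have ne: "B d \<noteq> []" if "d \<in> {1..D}" for d using blocks that by (auto simp: valid_blocks_def)
  define r r' where "r = flatZ (\<lambda>j. B (chi j))" and "r' = flatZ (\<lambda>j. B (chi' j))"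
  have rA: "r i \<in> A" for i
    using flatZ_in_blocks[of "\<lambda>j. B (chi j)" i, OF ne[OF chi]] chi unfolding r_def A_def by blast
  have r'A: "r' i \<in> A" for i
    using flatZ_in_blocks[of "\<lambda>j. B (chi' j)" i, OF ne[OF chi']] chi' unfolding r'_def A_def by blast
  have pos: "res_v u > 0 \<and> res_l u > 0 \<and> res_s u > 0" if "u \<in> A" for u
    using blocks that unfolding A_def valid_blocks_def by blast
  obtain K where K: "\<And>i. \<bar>coef_a r i\<bar> \<le> K" "\<And>i. \<bar>coef_b r i - lam\<bar> \<le> K"
    using coef_bounded[of A r lam, OF A rA] by blast
  obtain K' where K': "\<And>i. \<bar>coef_a r' i\<bar> \<le> K'" "\<And>i. \<bar>coef_b r' i - lam\<bar> \<le> K'"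
    using coef_bounded[of A r' lam, OF A r'A] by blast
  let ?T = "tri (coef_a r) (\<lambda>i. coef_b r i - lam)" and ?T' = "tri (coef_a r') (\<lambda>i. coef_b r' i - lam)"
  have a0: "coef_a r' i \<noteq> 0" for i by (rule coef_a_nonzero) (rule pos[OF r'A])
  have "\<exists>x\<in>l2 UNIV. ?T' x = y" if "y \<in> l2 UNIV"
    "\<And>\<epsilon>. \<epsilon> > 0 \<Longrightarrow> \<exists>x\<in>l2 UNIV. l2norm (\<lambda>i. ?T' x i - y i) < \<epsilon>" for y
    using fr that unfolding fredholm_on_def res_Z_eq_flatZ op_shift_jac_eq_tri r'_def by blast
  from tri_closed_range_bounded_below[of "coef_a r'" K' "\<lambda>i. coef_b r' i - lam", OF K' a0 this]
  obtain \<epsilon> R where \<epsilon>: "\<epsilon> > 0" and far: "\<And>x N. (\<forall>i. \<bar>i\<bar> > N \<or> \<bar>i\<bar> \<le> R \<longrightarrow> x i = 0) \<Longrightarrow>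
      \<epsilon> * l2norm x \<le> l2norm (?T' x)" by blast
  have "\<epsilon> * l2norm x \<le> l2norm (?T x)" if x: "\<And>i. \<bar>i\<bar> > int N \<Longrightarrow> x i = 0" for x and N :: nat
  proof -
    \<comment> \<open>Translating \<open>x\<close> needs coefficients up to distance
      \<open>N + 1\<close>, and these read resonators one site further out, hence
      \<open>N + 2\<close>.\<close>
    obtain p where p: "\<And>i. \<bar>i\<bar> \<le> int (N + 2) \<Longrightarrow> r' (p + i) = r i \<and> int (nat R) < \<bar>p + i\<bar>"
      using pseudo_ergodic_far_copy[of D chi' B chi "N + 2" "nat R", OF pe D ne chi' chi]
      unfolding r_def r'_def by blast
    have shift: "l2norm (\<lambda>i. y (i - p)) = l2norm y" for y using l2norm_shift[of y "- p"] by simp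
    have co: "coef_a r' (p + i) = coef_a r i \<and> coef_b r' (p + i) - lam = coef_b r i - lam"
      if "\<bar>i\<bar> \<le> int N + 1" for i
    proof -
      have "r' (p + i) = r i" "r' (p + i + 1) = r (i + 1)" "r' (p + i - 1) = r (i - 1)"
        using p[of i] p[of "i + 1"] p[of "i - 1"] that by (auto simp: algebra_simps)
      then show ?thesis by (simp add: coef_a_def coef_b_def)
    qed
    have "x (i - p) = 0" if "\<bar>i\<bar> > int N + \<bar>p\<bar> \<or> \<bar>i\<bar> \<le> R" for i
    proof (rule ccontr)
      assume "x (i - p) \<noteq> 0"
      then have "\<bar>i - p\<bar> \<le> int N" using x[of "i - p"] by force
      then show False using p[of "i - p"] that by (auto split: if_splits)
    qed
    then have "\<epsilon> * l2norm (\<lambda>i. x (i - p)) \<le> l2norm (?T' (\<lambda>i. x (i - p)))"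
      by (intro far[of "int N + \<bar>p\<bar>"]) blast
    also have "?T' (\<lambda>i. x (i - p)) = (\<lambda>i. ?T x (i - p))"
      by (rule tri_translate[where N="int N"]) (use x co in auto)
    finally show ?thesis unfolding shift[of x] shift[of "?T x"] .
  qed
  from tri_bounded_below_from_finite_support[of "coef_a r" K "\<lambda>i. coef_b r i - lam", OF K \<epsilon> this]
  have "\<And>x. x \<in> l2 UNIV \<Longrightarrow> \<epsilon> * l2norm x \<le> l2norm (?T x)" .
  with \<epsilon> show ?thesis unfolding op_shift_jac_eq_tri r_def by blast
qed

section \<open>Half-line operators\<close>

text \<open>The lower bound gives uniqueness and a bounded inverse; existence comes from symmetry
  through \<open>tri_surjective\<close>.\<close>

lemma tri_invertible_on:
  assumes a: "\<And>i. \<bar>a i\<bar> \<le> K" and d: "\<And>i. \<bar>d i\<bar> \<le> K"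
    and T: "\<And>x. x \<in> l2 S \<Longrightarrow> T x = tri a d x"
    and inv: "\<And>x. x \<in> l2 S \<Longrightarrow> tri a d x \<in> l2 S"
    and c: "c > 0" and below: "\<And>x. x \<in> l2 S \<Longrightarrow> c * l2norm x \<le> l2norm (tri a d x)"
  shows "invertible_on (l2 S) T"
  unfolding invertible_on_def
proof (intro conjI ballI)
  have U: "x \<in> l2 UNIV" if "x \<in> l2 S" for x using that l2_iff by blast
  show "bounded_op_on (l2 S) T"
    unfolding bounded_op_on_def
  proof (intro conjI ballI allI)
    show "\<exists>C. \<forall>x\<in>l2 S. l2norm (T x) \<le> C * l2norm x"
      using tri_bounded(2)[of a K d, OF a d U] T by (intro exI[of _ "3 * K"]) simp
    fix x assume x: "x \<in> l2 S"
    show "T x \<in> l2 S" using inv T x by simp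
    fix y \<alpha> \<beta> assume y: "y \<in> l2 S"
    show "T (\<lambda>i. \<alpha> * x i + \<beta> * y i) = (\<lambda>i. \<alpha> * T x i + \<beta> * T y i)"
      using T[OF x] T[OF y] T[OF l2_add(1)[OF l2_cmult[OF x] l2_cmult[OF y]]] by (simp add: tri_lin)
  qed
  show "\<exists>C. \<forall>x\<in>l2 S. l2norm x \<le> C * l2norm (T x)"
    using below T c by (intro exI[of _ "1 / c"]) (simp add: field_simps)
  fix y assume y: "y \<in> l2 S"
  obtain x where x: "x \<in> l2 S" "tri a d x = y"
    using tri_surjective[of a K d S c y, OF a d inv c below y] by blast
  show "\<exists>!x. x \<in> l2 S \<and> T x = y"
  proof (rule ex1I[of _ x])
    show "x \<in> l2 S \<and> T x = y" using x T by simp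
    fix x' assume x': "x' \<in> l2 S \<and> T x' = y"
    have e: "(\<lambda>i. x' i - x i) \<in> l2 S" using x x' by (intro l2_diff) auto
    have "tri a d (\<lambda>i. x' i - x i) = (\<lambda>i. 0)" using x x' T[of x'] by (simp add: tri_diff fun_eq_iff)
    then have "c * l2norm (\<lambda>i. x' i - x i) \<le> 0" using below[OF e] by simp
    then have "l2norm (\<lambda>i. x' i - x i) \<le> 0" using c by (simp add: mult_le_0_iff)
    then have "cmod (x' i - x i) \<le> 0" for i using cmod_le_l2norm[OF U[OF e], of i] by linarith
    then show "x' = x" by (auto simp: fun_eq_iff)
  qed
qed

section \<open>Half-line operators as tridiagonal operators on the integers\<close>

definition plus_a :: "(int \<Rightarrow> resonator) \<Rightarrow> int \<Rightarrow> real" where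
  "plus_a r i = (if i < 0 then 0 else coef_a r i)"

definition plus_d :: "(int \<Rightarrow> resonator) \<Rightarrow> real \<Rightarrow> int \<Rightarrow> real" where
  "plus_d r lam i = (if i < 0 then 0
     else if i = 0 then (res_v (r 0))\<^sup>2 / (res_l (r 0) * res_s (r 0)) - lam else coef_b r i - lam)"

text \<open>The value at -1 is already zero because that entry couples the sites -1 and 0 across the
  cut.\<close>

definition minus_a :: "(int \<Rightarrow> resonator) \<Rightarrow> int \<Rightarrow> real" where
  "minus_a r i = (if -1 \<le> i then 0 else coef_a r i)"

definition minus_d :: "(int \<Rightarrow> resonator) \<Rightarrow> real \<Rightarrow> int \<Rightarrow> real" where
  "minus_d r lam i = (if 0 \<le> i then 0
     else if i = -1 then (res_v (r (-1)))\<^sup>2 / (res_l (r (-1)) * res_s (r (-2))) - lam else coef_b r i - lam)"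

lemma jac_plus_eq_tri:
  assumes "x \<in> l2 {0..}"
  shows "op_shift (jac_plus r) lam x = tri (plus_a r) (plus_d r lam) x"
proof
  fix i :: int
  consider "i < 0" | "i = 0" | "i > 0" by linarith
  then show "op_shift (jac_plus r) lam x i = tri (plus_a r) (plus_d r lam) x i"
    using assms
    by cases (auto simp: l2_def op_shift_def jac_plus_def jac_def tri_def plus_a_def plus_d_def
        scaleR_conv_of_real algebra_simps)
qed

lemma jac_minus_eq_tri:
  assumes "x \<in> l2 {..-1}"
  shows "op_shift (jac_minus r) lam x = tri (minus_a r) (minus_d r lam) x"
proof
  fix i :: int
  consider "i < -1" | "i = -1" | "i \<ge> 0" by linarith
  then show "op_shift (jac_minus r) lam x i = tri (minus_a r) (minus_d r lam) x i"
    using assms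
    by cases (auto simp: l2_def op_shift_def jac_minus_def jac_def tri_def minus_a_def minus_d_def
        scaleR_conv_of_real algebra_simps)
qed

lemma plus_bounded:
  assumes "\<And>i. \<bar>coef_a r i\<bar> \<le> K" "\<And>i. \<bar>coef_b r i - lam\<bar> \<le> K"
  shows "\<exists>K'. \<forall>i. \<bar>plus_a r i\<bar> \<le> K' \<and> \<bar>plus_d r lam i\<bar> \<le> K'"
proof -
  let ?e = "\<bar>(res_v (r 0))\<^sup>2 / (res_l (r 0) * res_s (r 0)) - lam\<bar>"
  have K: "K \<ge> 0" using assms(1)[of 0] by linarith
  have "\<bar>plus_a r i\<bar> \<le> K + ?e" for i using assms(1)[of i] K by (auto simp: plus_a_def)
  moreover have "\<bar>plus_d r lam i\<bar> \<le> K + ?e" for i using assms(2)[of i] K by (auto simp: plus_d_def)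
  ultimately show ?thesis by blast
qed

lemma minus_bounded:
  assumes "\<And>i. \<bar>coef_a r i\<bar> \<le> K" "\<And>i. \<bar>coef_b r i - lam\<bar> \<le> K"
  shows "\<exists>K'. \<forall>i. \<bar>minus_a r i\<bar> \<le> K' \<and> \<bar>minus_d r lam i\<bar> \<le> K'"
proof -
  let ?e = "\<bar>(res_v (r (-1)))\<^sup>2 / (res_l (r (-1)) * res_s (r (-2))) - lam\<bar>"
  have K: "K \<ge> 0" using assms(1)[of 0] by linarith
  have "\<bar>minus_a r i\<bar> \<le> K + ?e" for i using assms(1)[of i] K by (auto simp: minus_a_def)
  moreover have "\<bar>minus_d r lam i\<bar> \<le> K + ?e" for i using assms(2)[of i] K by (auto simp: minus_d_def)
  ultimately show ?thesis by blast
qed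

lemma plus_invariant:
  assumes a: "\<And>i. \<bar>plus_a r i\<bar> \<le> K" and d: "\<And>i. \<bar>plus_d r lam i\<bar> \<le> K" and x: "x \<in> l2 {0..}"
  shows "tri (plus_a r) (plus_d r lam) x \<in> l2 {0..}"
proof -
  have "tri (plus_a r) (plus_d r lam) x \<in> l2 UNIV"
    using x l2_iff by (intro tri_bounded(1)[of "plus_a r" K "plus_d r lam", OF a d]) blast
  then show ?thesis by (simp add: l2_iff[of _ "{0..}"] tri_def plus_a_def plus_d_def)
qed

lemma minus_invariant:
  assumes a: "\<And>i. \<bar>minus_a r i\<bar> \<le> K" and d: "\<And>i. \<bar>minus_d r lam i\<bar> \<le> K" and x: "x \<in> l2 {..-1}"
  shows "tri (minus_a r) (minus_d r lam) x \<in> l2 {..-1}"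
proof -
  have "tri (minus_a r) (minus_d r lam) x \<in> l2 UNIV"
    using x l2_iff by (intro tri_bounded(1)[of "minus_a r" K "minus_d r lam", OF a d]) blast
  then show ?thesis by (simp add: l2_iff[of _ "{..-1}"] tri_def minus_a_def minus_d_def)
qed

text \<open>The bulk operator differs from the direct sum of the two half-line operators by
  \<open>s\<^sup>-\<^sup>1 w w\<^sup>T\<close>, where \<open>s\<close> is the spacing across the cut and \<open>w = (P, -Q)\<close>; the hypothesis on \<open>x\<close> and
  \<open>y\<close> says that their sum is orthogonal to \<open>w\<close>.\<close>
lemma tri_glue:
  assumes pos: "\<And>i. res_v (r i) > 0 \<and> res_l (r i) > 0 \<and> res_s (r i) > 0"
    and x: "x \<in> l2 {0..}" and y: "y \<in> l2 {..-1}"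
    and P: "P = res_v (r (-1)) / sqrt (res_l (r (-1)))" and Q: "Q = res_v (r 0) / sqrt (res_l (r 0))"
    and orth: "of_real P * y (-1) = of_real Q * x 0"
  shows "tri (coef_a r) (\<lambda>i. coef_b r i - lam) (\<lambda>i. y i + x i)
    = (\<lambda>i. tri (minus_a r) (minus_d r lam) y i + tri (plus_a r) (plus_d r lam) x i)"
proof
  fix i :: int
  define s where "s = res_s (r (-1))"
  have x0: "x i = 0" if "i < 0" for i using x that by (simp add: l2_def)
  have y0: "y i = 0" if "i \<ge> 0" for i using y that by (simp add: l2_def)
  \<comment> \<open>\<open>ca\<close>, \<open>b0\<close> and \<open>b1\<close> identify the
    difference from the direct sum: on the sites -1 and 0 it is the matrix with diagonal
    \<open>P * P / s\<close>, \<open>Q * Q / s\<close> and off-diagonal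
    \<open>- (P * Q / s)\<close>.\<close>
  have ca: "coef_a r (-1) = - (P * Q / s)"
    using pos[of 0] pos[of "-1"] by (simp add: coef_a_def P Q s_def real_sqrt_mult field_simps)
  have QQ: "Q * Q = (res_v (r 0))\<^sup>2 / res_l (r 0)" and PP: "P * P = (res_v (r (-1)))\<^sup>2 / res_l (r (-1))"
    using pos[of 0] pos[of "-1"] by (simp_all add: P Q power2_eq_square)
  have b0: "coef_b r 0 = (res_v (r 0))\<^sup>2 / (res_l (r 0) * res_s (r 0)) + Q * Q / s"
    unfolding QQ by (simp add: coef_b_def s_def distrib_left)
  have b1: "coef_b r (-1) = (res_v (r (-1)))\<^sup>2 / (res_l (r (-1)) * res_s (r (-2))) + P * P / s"
    unfolding PP by (simp add: coef_b_def s_def distrib_left)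
  consider "i < -1" | "i = -1" | "i = 0" | "i > 0" by linarith
  then show "tri (coef_a r) (\<lambda>i. coef_b r i - lam) (\<lambda>i. y i + x i) i
    = tri (minus_a r) (minus_d r lam) y i + tri (plus_a r) (plus_d r lam) x i"
  proof cases
    case 1
    then show ?thesis by (simp add: tri_def x0 minus_a_def minus_d_def plus_a_def plus_d_def)
  next
    case 2
    have "- (P * Q / s) *\<^sub>R x 0 + (P * P / s) *\<^sub>R y (-1)
        = of_real (P / s) * (of_real P * y (-1) - of_real Q * x 0)"
      by (simp add: scaleR_conv_of_real algebra_simps)
    then have "- (P * Q / s) *\<^sub>R x 0 + (P * P / s) *\<^sub>R y (-1) = 0" by (simp add: orth)
    then show ?thesis using 2
      by (simp add: tri_def x0 y0 minus_a_def minus_d_def plus_a_def plus_d_def ca b1 algebra_simps)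
  next
    case 3
    have "- (P * Q / s) *\<^sub>R y (-1) + (Q * Q / s) *\<^sub>R x 0
        = of_real (Q / s) * (of_real Q * x 0 - of_real P * y (-1))"
      by (simp add: scaleR_conv_of_real algebra_simps)
    then have "- (P * Q / s) *\<^sub>R y (-1) + (Q * Q / s) *\<^sub>R x 0 = 0" by (simp add: orth)
    then show ?thesis using 3
      by (simp add: tri_def x0 y0 minus_a_def minus_d_def plus_a_def plus_d_def ca b0 algebra_simps)
  next
    case 4
    then show ?thesis by (simp add: tri_def y0 minus_a_def minus_d_def plus_a_def plus_d_def)
  qed
qed

text \<open>After rescaling, a violator on each side glues to a vector on which the bulk operator is
  a direct sum. Squared norms add over the disjoint halves, so the two violations add up to a
  violation in the bulk.\<close>

lemma half_line_bounded_below: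
  assumes pos: "\<And>i. res_v (r i) > 0 \<and> res_l (r i) > 0 \<and> res_s (r i) > 0"
    and K: "\<And>i. \<bar>coef_a r i\<bar> \<le> K" "\<And>i. \<bar>coef_b r i - lam\<bar> \<le> K"
    and below: "\<And>x. x \<in> l2 UNIV \<Longrightarrow> \<epsilon> * l2norm x \<le> l2norm (tri (coef_a r) (\<lambda>i. coef_b r i - lam) x)"
    and \<epsilon>: "\<epsilon> > 0"
  shows "(\<forall>x\<in>l2 {0..}. \<epsilon> * l2norm x \<le> l2norm (tri (plus_a r) (plus_d r lam) x))
       \<or> (\<forall>x\<in>l2 {..-1}. \<epsilon> * l2norm x \<le> l2norm (tri (minus_a r) (minus_d r lam) x))"
proof (rule ccontr)
  let ?Tp = "tri (plus_a r) (plus_d r lam)" and ?Tm = "tri (minus_a r) (minus_d r lam)"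
  assume "\<not> ?thesis"
  then obtain x y where x: "x \<in> l2 {0..}" and xlt: "l2norm (?Tp x) < \<epsilon> * l2norm x"
    and y: "y \<in> l2 {..-1}" and ylt: "l2norm (?Tm y) < \<epsilon> * l2norm y" by (auto simp: not_le)
  define P Q where "P = res_v (r (-1)) / sqrt (res_l (r (-1)))" and "Q = res_v (r 0) / sqrt (res_l (r 0))"
  \<comment> \<open>One linear equation in two unknowns: the two boundary values serve crosswise as
    coefficients, and if both vanish any pair will do.\<close>
  obtain \<alpha> \<beta> :: complex where ab: "\<alpha> \<noteq> 0 \<or> \<beta> \<noteq> 0"
    and orth: "of_real P * (\<alpha> * y (-1)) = of_real Q * (\<beta> * x 0)"
  proof (cases "of_real P * y (-1) = 0 \<and> of_real Q * x 0 = 0")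
    case True
    show thesis by (rule that[of 1 1]) (use True in auto)
  next
    case False
    show thesis by (rule that[of "of_real Q * x 0" "of_real P * y (-1)"]) (use False in auto)
  qed
  define u w where "u i = \<beta> * x i" and "w i = \<alpha> * y i" for i
  have u: "u \<in> l2 {0..}" and w: "w \<in> l2 {..-1}" unfolding u_def w_def by (intro l2_cmult x y)+
  have nu: "l2norm u = cmod \<beta> * l2norm x" "l2norm (?Tp u) = cmod \<beta> * l2norm (?Tp x)"
    unfolding u_def tri_cmult[abs_def] by (rule l2norm_cmult)+
  have nw: "l2norm w = cmod \<alpha> * l2norm y" "l2norm (?Tm w) = cmod \<alpha> * l2norm (?Tm y)"
    unfolding w_def tri_cmult[abs_def] by (rule l2norm_cmult)+
  have U: "v \<in> l2 UNIV" if "v \<in> l2 S" for v S using that l2_iff by blast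
  obtain Kp where Kp: "\<And>i. \<bar>plus_a r i\<bar> \<le> Kp" "\<And>i. \<bar>plus_d r lam i\<bar> \<le> Kp"
    using plus_bounded[of r K lam, OF K] by blast
  obtain Km where Km: "\<And>i. \<bar>minus_a r i\<bar> \<le> Km" "\<And>i. \<bar>minus_d r lam i\<bar> \<le> Km"
    using minus_bounded[of r K lam, OF K] by blast
  have split: "(l2norm (\<lambda>i. g i + f i))\<^sup>2 = (l2norm g)\<^sup>2 + (l2norm f)\<^sup>2"
    if f: "f \<in> l2 {0..}" and g: "g \<in> l2 {..-1}" for f g
  proof (rule l2norm_sq_disjoint_add[OF U[OF g] U[OF f]])
    show "g i = 0 \<or> f i = 0" for i using f g by (cases "i < 0") (auto simp: l2_def)
  qed
  have T: "tri (coef_a r) (\<lambda>i. coef_b r i - lam) (\<lambda>i. w i + u i) = (\<lambda>i. ?Tm w i + ?Tp u i)"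
    by (rule tri_glue[OF pos u w P_def Q_def]) (use orth in \<open>simp add: u_def w_def\<close>)
  have "(\<epsilon> * l2norm (\<lambda>i. w i + u i))\<^sup>2 \<le> (l2norm (\<lambda>i. ?Tm w i + ?Tp u i))\<^sup>2"
    unfolding T[symmetric] using \<epsilon> by (intro power_mono below l2_add(1) U[OF u] U[OF w]) auto
  then have le: "\<epsilon>\<^sup>2 * ((l2norm w)\<^sup>2 + (l2norm u)\<^sup>2) \<le> (l2norm (?Tm w))\<^sup>2 + (l2norm (?Tp u))\<^sup>2"
    by (simp add: power_mult_distrib split[OF u w]
        split[OF plus_invariant[of r Kp lam, OF Kp u] minus_invariant[of r Km lam, OF Km w]])
  \<comment> \<open>One of the scalars may be zero, where only the weak inequality remains; the
    other is non-zero and supplies the strict one.\<close>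
  have sq: "(cmod c * s)\<^sup>2 \<le> \<epsilon>\<^sup>2 * (cmod c * t)\<^sup>2 \<and> (c \<noteq> 0 \<longrightarrow> (cmod c * s)\<^sup>2 < \<epsilon>\<^sup>2 * (cmod c * t)\<^sup>2)"
    if "0 \<le> s" "s < \<epsilon> * t" for s t c
  proof -
    have "s\<^sup>2 < \<epsilon>\<^sup>2 * t\<^sup>2" using power_strict_mono[OF that(2,1), of 2] by (simp add: power_mult_distrib)
    then show ?thesis
      by (cases "c = 0") (simp_all add: power_mult_distrib mult.left_commute[of "\<epsilon>\<^sup>2"])
  qed
  show False
    using le ab sq[OF l2norm_nonneg xlt, of \<beta>] sq[OF l2norm_nonneg ylt, of \<alpha>]
    unfolding nu nw distrib_left by linarith
qed

theorem theorem4p6: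
  fixes D :: nat and B :: "nat \<Rightarrow> resonator list" and lam :: real
    and chip :: "nat \<Rightarrow> nat"
  assumes blocks: "valid_blocks D B"
    and lam_nonneg: "lam \<ge> 0"
    and ex: "\<exists>chi'::int \<Rightarrow> nat. (\<forall>j. chi' j \<in> {1..D}) \<and> pseudo_ergodic D chi' \<and>
               fredholm_on (l2 UNIV) (op_shift (jac (res_Z B chi')) lam)"
    and chi: "\<forall>k. chip k \<in> {1..D}"
  shows "invertible_on (l2 {0..}) (op_shift (jac_plus (res_half B chip)) lam)
       \<or> invertible_on (l2 {..-1}) (op_shift (jac_minus (res_half B chip)) lam)"
proof -
  \<comment> \<open>The given sequence on the right and its mirror image on the left, so that
    cutting at the origin yields exactly the two half-line operators.\<close>
  define chi where "chi j = chip (if 0 \<le> j then nat j else nat (- 1 - j))" for j :: int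
  define r where "r = res_half B chip"
  have r: "r = flatZ (\<lambda>j. B (chi j))" by (simp add: r_def res_half_eq_flatZ chi_def)
  have chi_D: "chi j \<in> {1..D}" for j using chi by (simp add: chi_def)
  obtain chi' where "\<And>j. chi' j \<in> {1..D}" "pseudo_ergodic D chi'"
    "fredholm_on (l2 UNIV) (op_shift (jac (res_Z B chi')) lam)" using ex by blast
  from fredholm_imp_bounded_below_all[of D B chi' lam chi, OF blocks this chi_D]
  have "\<exists>\<epsilon>>0. \<forall>x\<in>l2 UNIV. \<epsilon> * l2norm x \<le> l2norm (tri (coef_a r) (\<lambda>i. coef_b r i - lam) x)"
    unfolding r op_shift_jac_eq_tri .
  then obtain \<epsilon> where \<epsilon>: "\<epsilon> > 0"
    and below: "\<And>x. x \<in> l2 UNIV \<Longrightarrow> \<epsilon> * l2norm x \<le> l2norm (tri (coef_a r) (\<lambda>i. coef_b r i - lam) x)"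
    by auto
  define A where "A = (\<Union>d\<in>{1..D}. set (B d))"
  have A: "finite A" by (simp add: A_def)
  have ne: "B (chi j) \<noteq> []" for j using blocks chi_D by (auto simp: valid_blocks_def)
  have rA: "r i \<in> A" for i
    using flatZ_in_blocks[of "\<lambda>j. B (chi j)" i, OF ne] chi_D unfolding r A_def by blast
  have pos: "res_v (r i) > 0 \<and> res_l (r i) > 0 \<and> res_s (r i) > 0" for i
    using blocks rA[of i] unfolding A_def valid_blocks_def by blast
  obtain K where K: "\<And>i. \<bar>coef_a r i\<bar> \<le> K" "\<And>i. \<bar>coef_b r i - lam\<bar> \<le> K"
    using coef_bounded[of A r lam, OF A rA] by blast
  obtain Kp where Kp: "\<And>i. \<bar>plus_a r i\<bar> \<le> Kp" "\<And>i. \<bar>plus_d r lam i\<bar> \<le> Kp"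
    using plus_bounded[of r K lam, OF K] by blast
  obtain Km where Km: "\<And>i. \<bar>minus_a r i\<bar> \<le> Km" "\<And>i. \<bar>minus_d r lam i\<bar> \<le> Km"
    using minus_bounded[of r K lam, OF K] by blast
  from half_line_bounded_below[of r K lam \<epsilon>, OF pos K below \<epsilon>] show ?thesis
  proof
    assume "\<forall>x\<in>l2 {0..}. \<epsilon> * l2norm x \<le> l2norm (tri (plus_a r) (plus_d r lam) x)"
    then have "invertible_on (l2 {0..}) (op_shift (jac_plus r) lam)"
      by (intro tri_invertible_on[of "plus_a r" Kp "plus_d r lam", OF Kp jac_plus_eq_tri
            plus_invariant[of r Kp lam, OF Kp] \<epsilon>]) auto
    then show ?thesis by (simp add: r_def)
  next
    assume "\<forall>x\<in>l2 {..-1}. \<epsilon> * l2norm x \<le> l2norm (tri (minus_a r) (minus_d r lam) x)"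
    then have "invertible_on (l2 {..-1}) (op_shift (jac_minus r) lam)"
      by (intro tri_invertible_on[of "minus_a r" Km "minus_d r lam", OF Km jac_minus_eq_tri
            minus_invariant[of r Km lam, OF Km] \<epsilon>]) auto
    then show ?thesis by (simp add: r_def)
  qed
qed

end
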